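(* Let $j=e^{2\pi i/3}$, $\theta=2\cos(2\pi/7)=\zeta_7+\zeta_7^{-1}$ with $\zeta_7=e^{2\pi i/7}$, $F=\mathbb{Q}(j)$, $K=\mathbb{Q}(j,\theta)$, let $\sigma$ be the generator of $\mathrm{Gal}(K/F)$ given by $\zeta_7+\zeta_7^{-1}\mapsto\zeta_7^2+\zeta_7^{-2}$, and let $\gamma=j$. Let $\alpha=(1+j)+\theta$ and $\mathcal{I}=\alpha\mathcal{O}_K$. Then $$\nu_1=(1+j)+\theta,\qquad \nu_2=(-1-2j)+j\theta^2,\qquad \nu_3=(-1-2j)+(1+j)\theta+(1+j)\theta^2$$ is a $\mathbb{Z}[j]$-basis of $\mathcal{I}$, and the $3\times3$ space-time code $\mathcal{C}(K/F,\sigma,\gamma,(\nu_k),c)$ with $c=7$ is perfect.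
   Context: $\mathcal{O}_L$ denotes the ring of integers of a number field $L$. Code: let $F$ be $\mathbb{Q}(i)$ or $\mathbb{Q}(j)$ with $j=e^{2\pi i/3}$, $K\subset\mathbb{C}$ a cyclic extension of $F$ of degree $n$, $\sigma$ a generator of $\mathrm{Gal}(K/F)$, $\gamma\in F^*$, $(\nu_1,\dots,\nu_n)$ an $\mathcal{O}_F$-basis of a nonzero ideal of $\mathcal{O}_K$, and $c>0$ a real number. Given information symbols $u_{\ell,k}\in\mathcal{O}_F$ ($0\le \ell\le n-1$, $1\le k\le n$), put $x_\ell=\sum_{k=1}^n u_{\ell,k}\nu_k$. The infinite code $\mathcal{C}(K/F,\sigma,\gamma,(\nu_k),c)$ is the set of all $n\times n$ complex matrices $\frac{1}{\sqrt c}X$, where (indices $r,s\in\{0,\dots,n-1\}$) $X_{r,s}=\sigma^r(x_{s-r})$ if $s\ge r$ and $X_{r,s}=\gamma\,\sigma^r(x_{s-r+n})$ if $s<r$. The code is called perfect if: (1) (full rate) it encodes $n^2$ information symbols, i.e. the symbols $u_{\ell,k}$ are determined by the codeword; (2) (non-vanishing determinant) there is $\delta>0$ such that $|\det \mathbf{X}|^2\ge\delta$ for every nonzero codeword $\mathbf{X}$ of the infinite code; (3) (shaping) the layer-encoding matrix $R=\frac{1}{\sqrt c}\big(\sigma^{r}(\nu_k)\big)_{0\le r\le n-1,\,1\le k\le n}$ is unitary; (4) (uniform average energy per antenna) $|\gamma|=1$. *)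

theory Defs
  imports
    "HOL-Algebra.Algebra"
    "HOL-Algebra.Algebraic_Closure_Type"
    "Jordan_Normal_Form.Schur_Decomposition"
begin

section \<open>Subfields of the complex numbers\<close>

abbreviation \<C> :: "complex ring" where
  "\<C> \<equiv> ring_of_type_algebra"

text \<open>The rationals lie in every subfield of the complex numbers, so \<open>adjoin S\<close> is \<open>Q(S)\<close>.\<close>

abbreviation adjoin :: "complex set \<Rightarrow> complex set" where
  "adjoin S \<equiv> generate_field \<C> S"

abbreviation subring_of :: "complex set \<Rightarrow> complex ring" where
  "subring_of A \<equiv> \<C>\<lparr>carrier := A\<rparr>"

definition ring_of_integers :: "complex set \<Rightarrow> complex set" where
  "ring_of_integers L = {x \<in> L. algebraic_int x}"

text \<open>As in \<^const>\<open>BijGroup\<close>, automorphisms of \<open>K\<close> are extensional functions,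
  so that two automorphisms agreeing on \<open>K\<close> are equal.\<close>

definition galois_group :: "complex set \<Rightarrow> complex set \<Rightarrow> (complex \<Rightarrow> complex) monoid" where
  "galois_group K F = BijGroup K
     \<lparr>carrier := {\<tau> \<in> Bij K. \<tau> \<in> Ring.ring_hom (subring_of K) (subring_of K) \<and> (\<forall>x\<in>F. \<tau> x = x)}\<rparr>"

definition generates_galois_group ::
    "complex set \<Rightarrow> complex set \<Rightarrow> (complex \<Rightarrow> complex) \<Rightarrow> bool" where
  "generates_galois_group K F \<sigma> \<longleftrightarrow>
     \<sigma> \<in> carrier (galois_group K F) \<and>
     generate (galois_group K F) {\<sigma>} = carrier (galois_group K F)"

definition galois_extension :: "complex set \<Rightarrow> complex set \<Rightarrow> nat \<Rightarrow> bool" where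
  "galois_extension K F n \<longleftrightarrow>
     subfield F \<C> \<and> subfield K \<C> \<and> F \<subseteq> K \<and> ring.dimension \<C> n F K \<and>
     {x \<in> K. \<forall>\<tau>\<in>carrier (galois_group K F). \<tau> x = x} = F"

definition cyclic_extension :: "complex set \<Rightarrow> complex set \<Rightarrow> nat \<Rightarrow> bool" where
  "cyclic_extension K F n \<longleftrightarrow>
     galois_extension K F n \<and> (\<exists>\<sigma>. generates_galois_group K F \<sigma>)"

definition is_basis :: "complex set \<Rightarrow> nat \<Rightarrow> (nat \<Rightarrow> complex) \<Rightarrow> complex set \<Rightarrow> bool" where
  "is_basis A n \<nu> I \<longleftrightarrow>
     {\<Sum>k=1..n. u k * \<nu> k | u. \<forall>k\<in>{1..n}. u k \<in> A} = I \<and>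
     (\<forall>u. (\<forall>k\<in>{1..n}. u k \<in> A) \<and> (\<Sum>k=1..n. u k * \<nu> k) = 0 \<longrightarrow> (\<forall>k\<in>{1..n}. u k = 0))"

section \<open>Space-time codes from cyclic extensions\<close>

definition code_parameters ::
    "complex set \<Rightarrow> complex set \<Rightarrow> nat \<Rightarrow> (complex \<Rightarrow> complex) \<Rightarrow> complex \<Rightarrow>
     (nat \<Rightarrow> complex) \<Rightarrow> real \<Rightarrow> bool" where
  "code_parameters K F n \<sigma> \<gamma> \<nu> c \<longleftrightarrow>
     (F = adjoin {\<i>} \<or> F = adjoin {exp (2 * of_real pi * \<i> / 3)}) \<and>
     cyclic_extension K F n \<and>
     generates_galois_group K F \<sigma> \<and>
     \<gamma> \<in> F \<and> \<gamma> \<noteq> 0 \<and>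
     (\<exists>I. ideal I (subring_of (ring_of_integers K)) \<and> I \<noteq> {0} \<and>
          is_basis (ring_of_integers F) n \<nu> I) \<and>
     c > 0"

definition information_symbols :: "complex set \<Rightarrow> nat \<Rightarrow> (nat \<Rightarrow> nat \<Rightarrow> complex) set" where
  "information_symbols F n = {u. \<forall>l<n. \<forall>k\<in>{1..n}. u l k \<in> ring_of_integers F}"

definition layer :: "nat \<Rightarrow> (nat \<Rightarrow> complex) \<Rightarrow> (nat \<Rightarrow> nat \<Rightarrow> complex) \<Rightarrow> nat \<Rightarrow> complex" where
  "layer n \<nu> u l = (\<Sum>k=1..n. u l k * \<nu> k)"

definition codeword ::
    "nat \<Rightarrow> (complex \<Rightarrow> complex) \<Rightarrow> complex \<Rightarrow> (nat \<Rightarrow> complex) \<Rightarrow> real \<Rightarrow>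
     (nat \<Rightarrow> nat \<Rightarrow> complex) \<Rightarrow> complex mat" where
  "codeword n \<sigma> \<gamma> \<nu> c u =
     complex_of_real (1 / sqrt c) \<cdot>\<^sub>m
     mat n n (\<lambda>(r, s). if s \<ge> r then (\<sigma> ^^ r) (layer n \<nu> u (s - r))
                       else \<gamma> * (\<sigma> ^^ r) (layer n \<nu> u (s + n - r)))"

definition infinite_code ::
    "complex set \<Rightarrow> nat \<Rightarrow> (complex \<Rightarrow> complex) \<Rightarrow> complex \<Rightarrow> (nat \<Rightarrow> complex) \<Rightarrow> real \<Rightarrow>
     complex mat set" where
  "infinite_code F n \<sigma> \<gamma> \<nu> c = codeword n \<sigma> \<gamma> \<nu> c ` information_symbols F n"

definition full_rate ::
    "complex set \<Rightarrow> nat \<Rightarrow> (complex \<Rightarrow> complex) \<Rightarrow> complex \<Rightarrow> (nat \<Rightarrow> complex) \<Rightarrow> real \<Rightarrow> bool" where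
  "full_rate F n \<sigma> \<gamma> \<nu> c \<longleftrightarrow>
     (\<forall>u\<in>information_symbols F n. \<forall>v\<in>information_symbols F n.
        codeword n \<sigma> \<gamma> \<nu> c u = codeword n \<sigma> \<gamma> \<nu> c v \<longrightarrow>
        (\<forall>l<n. \<forall>k\<in>{1..n}. u l k = v l k))"

definition nonvanishing_determinant ::
    "complex set \<Rightarrow> nat \<Rightarrow> (complex \<Rightarrow> complex) \<Rightarrow> complex \<Rightarrow> (nat \<Rightarrow> complex) \<Rightarrow> real \<Rightarrow> bool" where
  "nonvanishing_determinant F n \<sigma> \<gamma> \<nu> c \<longleftrightarrow>
     (\<exists>\<delta>>0. \<forall>C\<in>infinite_code F n \<sigma> \<gamma> \<nu> c. C \<noteq> 0\<^sub>m n n \<longrightarrow> (cmod (det C)) ^ 2 \<ge> \<delta>)"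

text \<open>Matrix columns are counted from \<open>0\<close>, the basis \<open>\<nu>\<close> from \<open>1\<close>.\<close>

definition layer_encoding_matrix ::
    "nat \<Rightarrow> (complex \<Rightarrow> complex) \<Rightarrow> (nat \<Rightarrow> complex) \<Rightarrow> real \<Rightarrow> complex mat" where
  "layer_encoding_matrix n \<sigma> \<nu> c =
     complex_of_real (1 / sqrt c) \<cdot>\<^sub>m mat n n (\<lambda>(r, k). (\<sigma> ^^ r) (\<nu> (k + 1)))"

definition unitary_mat :: "complex mat \<Rightarrow> bool" where
  "unitary_mat A \<longleftrightarrow> square_mat A \<and>
     A * mat_adjoint A = 1\<^sub>m (dim_row A) \<and> mat_adjoint A * A = 1\<^sub>m (dim_row A)"

definition perfect_code ::
    "complex set \<Rightarrow> nat \<Rightarrow> (complex \<Rightarrow> complex) \<Rightarrow> complex \<Rightarrow> (nat \<Rightarrow> complex) \<Rightarrow> real \<Rightarrow> bool" where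
  "perfect_code F n \<sigma> \<gamma> \<nu> c \<longleftrightarrow>
     full_rate F n \<sigma> \<gamma> \<nu> c \<and>
     nonvanishing_determinant F n \<sigma> \<gamma> \<nu> c \<and>
     unitary_mat (layer_encoding_matrix n \<sigma> \<nu> c) \<and>
     cmod \<gamma> = 1"

end

theory Submission
  imports Defs "HOL-Number_Theory.Cong"
begin

text \<open>Writing \<open>\<beta> = \<theta> - j\<close>, the norm of \<open>\<beta>\<close> is \<open>1 + 3j\<close>, an Eisenstein prime above \<open>7\<close>
  that ramifies totally in \<open>K/F\<close>, with residue field \<open>\<int>/7\<close> in which \<open>j\<close> becomes \<open>2\<close>.
  Since \<open>\<sigma>\<close> acts trivially on the residue field, the determinant of a codeword with first row \<open>(x, y, z)\<close>
  reduces modulo \<open>\<beta>\<close> to \<open>x\<^sup>3 + 2y\<^sup>3 + 4z\<^sup>3 - 6xyz\<close>, which has no nontrivial zero because \<open>2\<close> is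
  not a cube modulo \<open>7\<close>. Hence a zero determinant allows dividing \<open>x, y, z\<close> by \<open>\<beta>\<close> indefinitely, so
  up to the scaling factor the determinant of a nonzero codeword is a nonzero element of \<open>\<int>[j]\<close>.

  The ring of integers of \<open>K\<close> is found by means of the unitarity relations of \<open>\<nu>\<close>: if \<open>x\<close> is integral, then
  \<open>7x\<close> is the sum of \<open>Tr(x cnj \<nu>\<^sub>k) \<nu>\<^sub>k\<close> and lies in \<open>\<int>[j, \<theta>]\<close>; the factor \<open>7\<close> is removed with the
  norm, as \<open>\<theta> - 2\<close> has an Eisenstein minimal polynomial at \<open>7\<close>.\<close>

section \<open>Algebraic integers form a ring\<close>

text \<open>Provides lattices in the complex numbers as \<open>int_module.span B\<close>.\<close>

interpretation int_module: Modules.module "\<lambda>(n::int) (x::complex). of_int n * x"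
  by unfold_locales (auto simp: algebra_simps)

text \<open>Determinant trick: multiplication by \<open>x\<close> acts on the generators
  \<open>B\<close> through an integer matrix, and the vector listing \<open>B\<close> is an
  eigenvector for \<open>x\<close>, nonzero because it has the entry 1. So \<open>x\<close> is a
  root of a monic integral characteristic polynomial.\<close>

lemma algebraic_int_if_stable_lattice:
  fixes x :: complex
  assumes "finite B" "1 \<in> B" and stable: "\<And>b. b \<in> B \<Longrightarrow> x * b \<in> int_module.span B"
  shows "algebraic_int x"
proof -
  have "\<forall>b\<in>B. \<exists>c. x * b = (\<Sum>b'\<in>B. of_int (c b') * b')"
    using stable by (auto simp: int_module.span_finite[OF \<open>finite B\<close>])
  then obtain c where c: "\<And>b. b \<in> B \<Longrightarrow> x * b = (\<Sum>b'\<in>B. of_int (c b b') * b')"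
    by metis
  obtain bs where bs: "set bs = B" "distinct bs"
    using finite_distinct_list[OF \<open>finite B\<close>] by blast
  define n where "n = length bs"
  define A where "A = mat n n (\<lambda>(i, k). c (bs ! i) (bs ! k))"
  define A' where "A' = map_mat (of_int :: int \<Rightarrow> complex) A"
  define v where "v = vec n ((!) bs)"
  have A: "A \<in> carrier_mat n n" by (simp add: A_def)
  have A': "A' \<in> carrier_mat n n" using A by (simp add: A'_def)
  have "A' *\<^sub>v v = x \<cdot>\<^sub>v v"
  proof (rule eq_vecI)
    show "dim_vec (A' *\<^sub>v v) = dim_vec (x \<cdot>\<^sub>v v)" using A' by (simp add: v_def)
    fix i assume "i < dim_vec (x \<cdot>\<^sub>v v)"
    hence i: "i < n" by (simp add: v_def)
    hence "(A' *\<^sub>v v) $ i = (\<Sum>k<n. of_int (c (bs ! i) (bs ! k)) * bs ! k)"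
      using A' by (simp add: A'_def A_def v_def scalar_prod_def atLeast0LessThan)
    also have "\<dots> = (\<Sum>b\<in>B. of_int (c (bs ! i) b) * b)"
      using sum.reindex_bij_betw[OF bij_betw_nth[OF bs(2) _ bs(1)[symmetric]],
          of "{..<n}" "\<lambda>b. of_int (c (bs ! i) b) * b"] by (simp add: n_def)
    also have "\<dots> = x * bs ! i"
    proof (rule c[symmetric])
      show "bs ! i \<in> B" using i bs(1) nth_mem n_def by blast
    qed
    finally show "(A' *\<^sub>v v) $ i = (x \<cdot>\<^sub>v v) $ i" using i by (simp add: v_def)
  qed
  moreover have "v \<noteq> 0\<^sub>v n"
  proof -
    obtain i where "i < n" "bs ! i = 1"
      using \<open>1 \<in> B\<close> bs(1) by (metis in_set_conv_nth n_def)
    hence "v $ i \<noteq> 0\<^sub>v n $ i" by (simp add: v_def)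
    thus ?thesis by metis
  qed
  ultimately have "eigenvalue A' x"
    using A' by (auto simp: eigenvalue_def eigenvector_def v_def intro!: exI[of _ v])
  hence "poly (char_poly A') x = 0"
    using eigenvalue_root_char_poly[OF A'] by blast
  hence "poly (map_poly of_int (char_poly A)) x = 0"
    by (simp add: A'_def of_int_hom.char_poly_hom[OF A])
  thus ?thesis
    using degree_monic_char_poly[OF A] by (auto simp: algebraic_int_altdef_ipoly)
qed

lemma algebraic_int_power_reduce:
  fixes x :: complex
  assumes "algebraic_int x"
  obtains n c where "n > 0" "x ^ n = (\<Sum>i<n. of_int (c i) * x ^ i)"
proof -
  obtain p where p: "poly (map_poly of_int p) x = 0" "lead_coeff p = 1"
    using assms algebraic_int_altdef_ipoly by blast
  have "degree p > 0"
  proof (rule ccontr)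
    assume "\<not> degree p > 0"
    hence "p = 1" using p(2) by (metis degree_0_id gr0I one_pCons)
    thus False using p(1) by simp
  qed
  have "0 = (\<Sum>i\<le>degree p. of_int (coeff p i) * x ^ i)"
    using p(1) by (simp add: poly_altdef degree_map_poly coeff_map_poly)
  also have "\<dots> = (\<Sum>i<degree p. of_int (coeff p i) * x ^ i) + x ^ degree p"
    using p(2) by (simp add: lessThan_Suc_atMost[symmetric])
  finally have "x ^ degree p = - (\<Sum>i<degree p. of_int (coeff p i) * x ^ i)"
    by (simp add: eq_neg_iff_add_eq_0 add.commute)
  also have "\<dots> = (\<Sum>i<degree p. of_int (- coeff p i) * x ^ i)"
    by (simp add: sum_negf)
  finally show ?thesis by (rule that[OF \<open>degree p > 0\<close>])
qed

text \<open>The monomials \<open>x ^ i * y ^ k\<close> below the degrees of the two monic relations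
  generate the ring Z[x, y]: a product leaves this range only at a top power, which the relation
  rewrites. One lattice stable under both factors serves sums and products alike.\<close>

lemma algebraic_int_pair_lattice:
  fixes x y :: complex
  assumes "algebraic_int x" "algebraic_int y"
  obtains B where "finite B" "1 \<in> B"
    "\<And>b. b \<in> int_module.span B \<Longrightarrow> x * b \<in> int_module.span B"
    "\<And>b. b \<in> int_module.span B \<Longrightarrow> y * b \<in> int_module.span B"
proof -
  obtain n c where n: "n > 0" "x ^ n = (\<Sum>i<n. of_int (c i) * x ^ i)"
    using assms(1) algebraic_int_power_reduce by blast
  obtain m d where m: "m > 0" "y ^ m = (\<Sum>i<m. of_int (d i) * y ^ i)"
    using assms(2) algebraic_int_power_reduce by blast
  define B where "B = (\<lambda>(i, k). x ^ i * y ^ k) ` ({..<n} \<times> {..<m})"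
  have base: "x ^ i * y ^ k \<in> int_module.span B" if "i < n" "k < m" for i k
    using that by (intro int_module.span_base) (auto simp: B_def)
  have ext: "x * b \<in> int_module.span B"
    if "\<And>b. b \<in> B \<Longrightarrow> x * b \<in> int_module.span B" "b \<in> int_module.span B" for b x
    using that(2)
  proof (induction rule: int_module.span_induct_alt)
    case (step n b b')
    have "x * (of_int n * b + b') = of_int n * (x * b) + x * b'" by (simp add: algebra_simps)
    thus ?case using step that(1)
      by (simp add: int_module.span_add int_module.span_scale)
  qed (simp add: int_module.span_zero)
  have x: "x * b \<in> int_module.span B" if b: "b \<in> B" for b
  proof -
    obtain i k where ik: "i < n" "k < m" "b = x ^ i * y ^ k"
      using b by (auto simp: B_def)
    have "x * b = x ^ Suc i * y ^ k" using ik by simp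
    also have "\<dots> \<in> int_module.span B"
    proof (cases "Suc i < n")
      case False
      hence "Suc i = n" using ik by simp
      hence "x ^ Suc i * y ^ k = (\<Sum>i<n. of_int (c i) * x ^ i) * y ^ k"
        using n by simp
      also have "\<dots> = (\<Sum>i<n. of_int (c i) * (x ^ i * y ^ k))"
        by (simp add: sum_distrib_right mult.assoc)
      finally have "x ^ Suc i * y ^ k = (\<Sum>i<n. of_int (c i) * (x ^ i * y ^ k))" .
      thus ?thesis using base ik
        by (auto intro!: int_module.span_sum int_module.span_scale)
    qed (use base ik in blast)
    finally show ?thesis .
  qed
  have y: "y * b \<in> int_module.span B" if b: "b \<in> B" for b
  proof -
    obtain i k where ik: "i < n" "k < m" "b = x ^ i * y ^ k"
      using b by (auto simp: B_def)
    have "y * b = x ^ i * y ^ Suc k" using ik by simp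
    also have "\<dots> \<in> int_module.span B"
    proof (cases "Suc k < m")
      case False
      hence "Suc k = m" using ik by simp
      hence "x ^ i * y ^ Suc k = x ^ i * (\<Sum>k<m. of_int (d k) * y ^ k)"
        using m by simp
      also have "\<dots> = (\<Sum>k<m. of_int (d k) * (x ^ i * y ^ k))"
        by (simp add: sum_distrib_left mult.left_commute)
      finally have "x ^ i * y ^ Suc k = (\<Sum>k<m. of_int (d k) * (x ^ i * y ^ k))" .
      thus ?thesis using base ik
        by (auto intro!: int_module.span_sum int_module.span_scale)
    qed (use base ik in blast)
    finally show ?thesis .
  qed
  show ?thesis
  proof (rule that[of B])
    show "1 \<in> B"
      using n(1) m(1) by (auto simp: B_def intro!: image_eqI[of _ _ "(0, 0)"])
    show "finite B" by (simp add: B_def)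
    show "x * b \<in> int_module.span B" if "b \<in> int_module.span B" for b
      using x that by (rule ext)
    show "y * b \<in> int_module.span B" if "b \<in> int_module.span B" for b
      using y that by (rule ext)
  qed
qed

lemma algebraic_int_add:
  fixes x y :: complex
  assumes "algebraic_int x" "algebraic_int y"
  shows "algebraic_int (x + y)"
proof -
  obtain B where B: "finite B" "1 \<in> B"
    "\<And>b. b \<in> int_module.span B \<Longrightarrow> x * b \<in> int_module.span B"
    "\<And>b. b \<in> int_module.span B \<Longrightarrow> y * b \<in> int_module.span B"
    using algebraic_int_pair_lattice[OF assms] by blast
  show ?thesis
  proof (rule algebraic_int_if_stable_lattice[OF B(1,2)])
    fix b assume "b \<in> B"
    hence "b \<in> int_module.span B" by (rule int_module.span_base)
    hence "x * b + y * b \<in> int_module.span B" by (intro int_module.span_add B(3,4))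
    thus "(x + y) * b \<in> int_module.span B" by (simp only: distrib_right)
  qed
qed

lemma algebraic_int_mult:
  fixes x y :: complex
  assumes "algebraic_int x" "algebraic_int y"
  shows "algebraic_int (x * y)"
proof -
  obtain B where B: "finite B" "1 \<in> B"
    "\<And>b. b \<in> int_module.span B \<Longrightarrow> x * b \<in> int_module.span B"
    "\<And>b. b \<in> int_module.span B \<Longrightarrow> y * b \<in> int_module.span B"
    using algebraic_int_pair_lattice[OF assms] by blast
  show ?thesis
  proof (rule algebraic_int_if_stable_lattice[OF B(1,2)])
    fix b assume "b \<in> B"
    hence "b \<in> int_module.span B" by (rule int_module.span_base)
    hence "x * (y * b) \<in> int_module.span B" by (intro B(3,4))
    thus "x * y * b \<in> int_module.span B" by (simp only: mult.assoc)
  qed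
qed

section \<open>Subrings of the complex numbers\<close>

lemma complex_ring_simps [simp]:
  "carrier \<C> = UNIV" "\<one>\<^bsub>\<C>\<^esub> = 1" "\<zero>\<^bsub>\<C>\<^esub> = 0"
  "x \<oplus>\<^bsub>\<C>\<^esub> y = x + y" "x \<otimes>\<^bsub>\<C>\<^esub> y = x * y"
  by (simp_all add: ring_of_type_algebra_def)

lemma field_complex: "field \<C>"
  by (rule field_from_type_algebra)

lemma cring_complex: "cring \<C>"
  by (rule cring_from_type_algebra)

lemmas ring_complex = cring.axioms(1)[OF cring_complex]

lemma complex_ring_a_inv [simp]: "\<ominus>\<^bsub>\<C>\<^esub> x = - x"
  using abelian_group.minus_equality[OF ring.is_abelian_group[OF ring_complex], of "- x" x] by simp

lemma complex_ring_m_inv [simp]: "x \<noteq> 0 \<Longrightarrow> inv\<^bsub>\<C>\<^esub> x = inverse x"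
  using comm_monoid.comm_inv_char[OF cring.axioms(2)[OF cring_complex], of x "inverse x"] by simp

lemma subring_complexI:
  assumes "1 \<in> A" "\<And>x. x \<in> A \<Longrightarrow> - x \<in> A"
    "\<And>x y. x \<in> A \<Longrightarrow> y \<in> A \<Longrightarrow> x * y \<in> A" "\<And>x y. x \<in> A \<Longrightarrow> y \<in> A \<Longrightarrow> x + y \<in> A"
  shows "subring A \<C>"
  using assms by (intro ring.subringI[OF ring_complex]) auto

lemma subring_complexD:
  assumes "subring A \<C>"
  shows "1 \<in> A" "0 \<in> A" "x \<in> A \<Longrightarrow> - x \<in> A" "x \<in> A \<Longrightarrow> y \<in> A \<Longrightarrow> x * y \<in> A"
    "x \<in> A \<Longrightarrow> y \<in> A \<Longrightarrow> x + y \<in> A" "x \<in> A \<Longrightarrow> y \<in> A \<Longrightarrow> x - y \<in> A"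
    "x \<in> A \<Longrightarrow> x ^ n \<in> A" "of_nat n \<in> A" "of_int m \<in> A" "numeral k \<in> A"
    "(\<And>i. i \<in> S \<Longrightarrow> f i \<in> A) \<Longrightarrow> sum f S \<in> A"
proof -
  show 1: "1 \<in> A" and 0: "0 \<in> A"
    using subringE(2,3)[OF assms] by simp_all
  show minus: "- x \<in> A" if "x \<in> A" for x using subringE(5)[OF assms that] by simp
  show mult: "x * y \<in> A" if "x \<in> A" "y \<in> A" for x y using subringE(6)[OF assms that] by simp
  show add: "x + y \<in> A" if "x \<in> A" "y \<in> A" for x y using subringE(7)[OF assms that] by simp
  show "x - y \<in> A" if "x \<in> A" "y \<in> A" for x y using add[OF that(1) minus[OF that(2)]] by simp
  show "x ^ n \<in> A" if "x \<in> A" for x n using that by (induction n) (auto intro: mult 1)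
  show nat: "of_nat n \<in> A" for n by (induction n) (auto intro: add 1 0)
  show "of_int m \<in> A" for m by (cases m) (auto intro!: minus nat simp del: of_nat_Suc)
  show "numeral k \<in> A" using nat[of "numeral k"] by simp
  show "(\<And>i. i \<in> S \<Longrightarrow> f i \<in> A) \<Longrightarrow> sum f S \<in> A"
    by (induction S rule: infinite_finite_induct) (auto intro: add 0)
qed

lemma subring_Ints: "subring \<int> \<C>" and subring_Rats: "subring \<rat> \<C>"
  by (auto intro!: subring_complexI)

lemma subfield_complexI:
  assumes "subring A \<C>" "\<And>x. x \<in> A \<Longrightarrow> x \<noteq> 0 \<Longrightarrow> inverse x \<in> A"
  shows "subfield A \<C>"
  using assms by (intro field.subfieldI'[OF field_complex]) auto

lemma Rats_subset_subfield:
  assumes "subfield A \<C>"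
  shows "\<rat> \<subseteq> A"
proof
  fix x :: complex assume "x \<in> \<rat>"
  then obtain a b where x: "b > 0" "x = of_int a / of_int b" by (rule Rats_cases')
  have A: "subring A \<C>" using assms by (rule subfieldE(1))
  have "inverse (of_int b) \<in> A"
    using ring.subfield_m_inv(1)[OF ring_complex assms, of "of_int b"] x(1) subring_complexD(9)[OF A] by simp
  thus "x \<in> A" using subring_complexD[OF A] by (simp add: x divide_inverse)
qed

section \<open>Galois groups\<close>

lemma ring_hom_subring_iff:
  "f \<in> Ring.ring_hom (subring_of K) (subring_of K) \<longleftrightarrow>
     (\<forall>x\<in>K. f x \<in> K) \<and> (\<forall>x\<in>K. \<forall>y\<in>K. f (x * y) = f x * f y) \<and>
     (\<forall>x\<in>K. \<forall>y\<in>K. f (x + y) = f x + f y) \<and> f 1 = 1"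
  by (auto simp: Ring.ring_hom_def Pi_def)

lemma galois_group_carrier_iff:
  "f \<in> carrier (galois_group K F) \<longleftrightarrow>
     f \<in> extensional K \<and> bij_betw f K K \<and>
     (\<forall>x\<in>K. \<forall>y\<in>K. f (x * y) = f x * f y) \<and>
     (\<forall>x\<in>K. \<forall>y\<in>K. f (x + y) = f x + f y) \<and> f 1 = 1 \<and> (\<forall>x\<in>F. f x = x)"
  by (auto simp: galois_group_def ring_hom_subring_iff Bij_def dest: bij_betwE)

text \<open>\<open>galois_group\<close> merely cuts down the carrier of \<open>BijGroup\<close>, so
  closure under composition and inverses has to be checked; the inverse map inherits additivity and
  multiplicativity.\<close>

lemma group_galois_group:
  assumes K: "subring K \<C>" and "F \<subseteq> K"
  shows "group (galois_group K F)"
proof -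
  interpret B: group "BijGroup K" by (rule group_BijGroup)
  note K_closed = subring_complexD(1,4,5)[OF K]
  let ?H = "{\<tau> \<in> Bij K. \<tau> \<in> Ring.ring_hom (subring_of K) (subring_of K) \<and> (\<forall>x\<in>F. \<tau> x = x)}"
  have "subgroup ?H (BijGroup K)"
  proof (rule B.subgroupI)
    show "?H \<subseteq> carrier (BijGroup K)" by (auto simp: BijGroup_def)
    have "restrict (\<lambda>x. x) K \<in> ?H"
      using \<open>F \<subseteq> K\<close> K_closed by (auto simp: id_Bij ring_hom_subring_iff)
    thus "?H \<noteq> {}" by blast
  next
    fix f assume f: "f \<in> ?H"
    hence fB: "f \<in> Bij K" and fh: "f \<in> Ring.ring_hom (subring_of K) (subring_of K)" by auto
    have inj: "inv_into K f (f x) = x" if "x \<in> K" for x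
      using fB that by (simp add: Bij_def bij_betw_def)
    have add: "inv_into K f (x + y) = inv_into K f x + inv_into K f y" if "x \<in> K" "y \<in> K" for x y
      using fh that K_closed
      by (intro Bij_inv_into_lemma[OF _ fB]) (auto simp: ring_hom_subring_iff)
    have mult: "inv_into K f (x * y) = inv_into K f x * inv_into K f y" if "x \<in> K" "y \<in> K" for x y
      using fh that K_closed
      by (intro Bij_inv_into_lemma[OF _ fB]) (auto simp: ring_hom_subring_iff)
    have "f 1 = 1" using fh by (simp add: ring_hom_subring_iff)
    hence one: "inv_into K f 1 = 1" using inj[of 1] K_closed by simp
    have fix_F: "inv_into K f x = x" if "x \<in> F" for x
      using f that inj[of x] \<open>F \<subseteq> K\<close> by auto
    have "(\<lambda>x\<in>K. inv_into K f x) \<in> ?H"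
      using restrict_inv_into_Bij[OF fB] \<open>F \<subseteq> K\<close> K_closed add mult one fix_F
      by (auto simp: ring_hom_subring_iff Bij_inv_into_mem[OF fB])
    thus "inv\<^bsub>BijGroup K\<^esub> f \<in> ?H"
      by (simp only: inv_BijGroup[OF fB])
  next
    fix f g assume fg: "f \<in> ?H" "g \<in> ?H"
    hence "compose K f g \<in> Bij K" by (simp add: compose_Bij)
    hence "compose K f g \<in> ?H"
      using fg \<open>F \<subseteq> K\<close> K_closed
      by (auto simp: ring_hom_subring_iff compose_eq)
    thus "f \<otimes>\<^bsub>BijGroup K\<^esub> g \<in> ?H" using fg by (simp add: BijGroup_def)
  qed
  thus ?thesis unfolding galois_group_def by (rule B.subgroup_imp_group)
qed

section \<open>The field \<open>\<rat>(j, \<theta>)\<close> in coordinates\<close>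

text \<open>Generic in the set of coefficients, so that the fields (\<open>A = \<rat>\<close>) and
  their orders (\<open>A = \<int>\<close>) are treated at once.\<close>

definition quad_ext :: "complex \<Rightarrow> complex set \<Rightarrow> complex set" where
  "quad_ext j A = {a + b * j | a b. a \<in> A \<and> b \<in> A}"

definition cubic_ext :: "complex \<Rightarrow> complex set \<Rightarrow> complex set" where
  "cubic_ext \<theta> A = {a + b * \<theta> + c * \<theta>^2 | a b c. a \<in> A \<and> b \<in> A \<and> c \<in> A}"

lemma quad_extI: "a \<in> A \<Longrightarrow> b \<in> A \<Longrightarrow> a + b * j \<in> quad_ext j A"
  by (auto simp: quad_ext_def)

lemma cubic_extI: "a \<in> A \<Longrightarrow> b \<in> A \<Longrightarrow> c \<in> A \<Longrightarrow> a + b * \<theta> + c * \<theta>^2 \<in> cubic_ext \<theta> A"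
  by (auto simp: cubic_ext_def)

lemma quad_extE:
  assumes "x \<in> quad_ext j A"
  obtains a b where "a \<in> A" "b \<in> A" "x = a + b * j"
  using assms by (auto simp: quad_ext_def)

lemma cubic_extE:
  assumes "x \<in> cubic_ext \<theta> A"
  obtains a b c where "a \<in> A" "b \<in> A" "c \<in> A" "x = a + b * \<theta> + c * \<theta>^2"
  using assms by (auto simp: cubic_ext_def)

lemma quad_ext_mono: "A \<subseteq> B \<Longrightarrow> quad_ext j A \<subseteq> quad_ext j B"
  by (auto simp: quad_ext_def)

lemma cubic_ext_mono: "A \<subseteq> B \<Longrightarrow> cubic_ext \<theta> A \<subseteq> cubic_ext \<theta> B"
  by (auto simp: cubic_ext_def)

lemma quad_ext_generators:
  assumes "subring A \<C>"
  shows "A \<subseteq> quad_ext j A" "j \<in> quad_ext j A"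
  using quad_extI[of _ A 0 j] quad_extI[of 0 A 1 j] subring_complexD(1,2)[OF assms] by auto

lemma cubic_ext_generators:
  assumes "subring A \<C>"
  shows "A \<subseteq> cubic_ext \<theta> A" "\<theta> \<in> cubic_ext \<theta> A"
  using cubic_extI[of _ A 0 0 \<theta>] cubic_extI[of 0 A 1 0 \<theta>] subring_complexD(1,2)[OF assms] by auto

text \<open>The assumptions on \<open>\<theta>\<close> hold equally for its conjugates, so results
  of the locale transfer to \<open>\<theta>^2 - 2\<close> and
  \<open>1 - \<theta> - \<theta>^2\<close>.\<close>

locale eisenstein_cubic =
  fixes j \<theta> :: complex
  assumes j_square: "j^2 = - 1 - j"
    and \<theta>_cube: "\<theta>^3 = 1 + 2 * \<theta> - \<theta>^2"
    and \<theta>_real: "\<theta> \<in> \<real>"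
begin

abbreviation "Qj \<equiv> quad_ext j \<rat>"
abbreviation "Zj \<equiv> quad_ext j \<int>"
abbreviation "K \<equiv> cubic_ext \<theta> Qj"
abbreviation "ZK \<equiv> cubic_ext \<theta> Zj"

lemma subring_quad_ext:
  assumes "subring A \<C>"
  shows "subring (quad_ext j A) \<C>"
proof (rule subring_complexI)
  note C = subring_complexD(1-6)[OF assms]
  show "1 \<in> quad_ext j A" using quad_extI[OF C(1,2)] by simp
  fix x assume "x \<in> quad_ext j A"
  then obtain a b where x: "a \<in> A" "b \<in> A" "x = a + b * j" by (rule quad_extE)
  have "- x = - a + (- b) * j" using x by simp
  also have "\<dots> \<in> quad_ext j A" by (intro quad_extI C x)
  finally show "- x \<in> quad_ext j A" .
  fix y assume "y \<in> quad_ext j A"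
  then obtain c d where y: "c \<in> A" "d \<in> A" "y = c + d * j" by (rule quad_extE)
  have "x + y = (a + c) + (b + d) * j" by (simp add: x y algebra_simps)
  also have "\<dots> \<in> quad_ext j A" by (intro quad_extI C x y)
  finally show "x + y \<in> quad_ext j A" .
  have "x * y = (a * c - b * d) + (a * d + b * c - b * d) * j"
    unfolding x y using j_square by Groebner_Basis.algebra
  also have "\<dots> \<in> quad_ext j A" by (intro quad_extI C x y)
  finally show "x * y \<in> quad_ext j A" .
qed

lemma subring_cubic_ext:
  assumes "subring A \<C>"
  shows "subring (cubic_ext \<theta> A) \<C>"
proof (rule subring_complexI)
  note C = subring_complexD(1-6,10)[OF assms]
  show "1 \<in> cubic_ext \<theta> A" using cubic_extI[OF C(1,2,2)] by simp
  fix x assume "x \<in> cubic_ext \<theta> A"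
  then obtain a b c where x: "a \<in> A" "b \<in> A" "c \<in> A" "x = a + b * \<theta> + c * \<theta>^2" by (rule cubic_extE)
  have "- x = - a + (- b) * \<theta> + (- c) * \<theta>^2" using x by simp
  also have "\<dots> \<in> cubic_ext \<theta> A" by (intro cubic_extI C x)
  finally show "- x \<in> cubic_ext \<theta> A" .
  fix y assume "y \<in> cubic_ext \<theta> A"
  then obtain d e f where y: "d \<in> A" "e \<in> A" "f \<in> A" "y = d + e * \<theta> + f * \<theta>^2" by (rule cubic_extE)
  have "x + y = (a + d) + (b + e) * \<theta> + (c + f) * \<theta>^2" by (simp add: x y algebra_simps)
  also have "\<dots> \<in> cubic_ext \<theta> A" by (intro cubic_extI C x y)
  finally show "x + y \<in> cubic_ext \<theta> A" .
  have "x * y = (a * d + (b * f + c * e) - c * f) + (a * e + b * d + 2 * (b * f + c * e) - c * f) * \<theta>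
      + (a * f + b * e + c * d - (b * f + c * e) + 3 * (c * f)) * \<theta>^2"
    unfolding x y using \<theta>_cube by Groebner_Basis.algebra
  also have "\<dots> \<in> cubic_ext \<theta> A" by (intro cubic_extI C x y)
  finally show "x * y \<in> cubic_ext \<theta> A" .
qed

lemmas subring_Qj = subring_quad_ext[OF subring_Rats]
lemmas subring_Zj = subring_quad_ext[OF subring_Ints]
lemmas subring_K = subring_cubic_ext[OF subring_Qj]
lemmas subring_ZK = subring_cubic_ext[OF subring_Zj]

lemmas Qj_closed = subring_complexD(1-10)[OF subring_Qj]
lemmas Zj_closed = subring_complexD(1-10)[OF subring_Zj]
lemmas K_closed = subring_complexD(1-10)[OF subring_K]
lemmas ZK_closed = subring_complexD(1-10)[OF subring_ZK]

lemma j_mem: "j \<in> Qj" "j \<in> Zj" "j \<in> K" "j \<in> ZK"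
  and \<theta>_mem: "\<theta> \<in> K" "\<theta> \<in> ZK"
  using quad_ext_generators(2)[OF subring_Rats, of j] quad_ext_generators(2)[OF subring_Ints, of j]
    cubic_ext_generators[OF subring_Qj, of \<theta>] cubic_ext_generators[OF subring_Zj, of \<theta>] by auto

lemma Zj_subset_Qj: "Zj \<subseteq> Qj"
  by (intro quad_ext_mono) (auto elim: Ints_cases)

lemma Qj_subset_K: "Qj \<subseteq> K" and Zj_subset_ZK: "Zj \<subseteq> ZK"
  by (rule cubic_ext_generators[OF subring_Qj] cubic_ext_generators[OF subring_Zj])+

lemma ZK_subset_K: "ZK \<subseteq> K"
  by (intro cubic_ext_mono Zj_subset_Qj)

subsection \<open>Linear independence\<close>

lemma Im_j_nonzero: "Im j \<noteq> 0"
proof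
  assume "Im j = 0"
  hence "(Re j)^2 = - 1 - Re j" using arg_cong[OF j_square, of Re] by (simp add: Re_power2)
  moreover have "(2 * Re j + 1)^2 \<ge> 0" by simp
  ultimately show False by (simp add: power2_eq_square algebra_simps)
qed

text \<open>\<open>cnj j\<close> is a root of \<open>X^2 + X + 1\<close> other than
  \<open>j\<close>, and the two roots add up to -1.\<close>

lemma cnj_j: "cnj j = - 1 - j"
proof -
  have "(cnj j)^2 = - 1 - cnj j" using arg_cong[OF j_square, of cnj] by simp
  hence "(cnj j - j) * (cnj j + j + 1) = 0" using j_square by Groebner_Basis.algebra
  moreover have "cnj j - j \<noteq> 0" using Im_j_nonzero by (simp add: complex_eq_iff)
  ultimately have "cnj j + j + 1 = 0" by simp
  thus ?thesis by Groebner_Basis.algebra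
qed

lemma cnj_\<theta> [simp]: "cnj \<theta> = \<theta>"
  using \<theta>_real by (simp add: Reals_cnj_iff)

lemma Rats_subset_Reals: "\<rat> \<subseteq> (\<real> :: complex set)"
  by (auto elim!: Rats_cases' intro!: Reals_divide)

lemma real_j_independent:
  assumes "a \<in> \<real>" "b \<in> \<real>" "a + b * j = 0"
  shows "a = 0" "b = 0"
proof -
  have "b * j = - a" using assms(3) by Groebner_Basis.algebra
  moreover have "Im (b * j) = Re b * Im j" using assms(2) by (auto elim!: Reals_cases)
  moreover have "Im (- a) = 0" using assms(1) by (auto elim!: Reals_cases)
  ultimately have "Re b = 0" using Im_j_nonzero by simp
  thus "b = 0" using assms(2) by (auto elim!: Reals_cases)
  thus "a = 0" using assms(3) by simp
qed

text \<open>The norm of \<open>a + b * \<theta> + c * \<theta>^2\<close> over Q(j) as a polynomial.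
  It is polymorphic because parity is studied over \<open>int\<close> and factorization over
  \<open>complex\<close>.\<close>

definition norm_form :: "'a::comm_ring_1 \<Rightarrow> 'a \<Rightarrow> 'a \<Rightarrow> 'a" where
  "norm_form a b c = a^3 + b^3 + c^3 - a^2 * b + 5 * a^2 * c - 2 * a * b^2 - b^2 * c
     + 6 * a * c^2 - 2 * b * c^2 - a * b * c"

text \<open>The other two roots of the cubic are \<open>\<theta>^2 - 2\<close> and
  \<open>1 - \<theta> - \<theta>^2\<close>, so this is the product of the three conjugates, written
  out before any automorphism is available.\<close>

lemma norm_form_eq:
  "norm_form a b c = (a + b * \<theta> + c * \<theta>^2) *
     ((a + b * (\<theta>^2 - 2) + c * (\<theta>^2 - 2)^2) * (a + b * (1 - \<theta> - \<theta>^2) + c * (1 - \<theta> - \<theta>^2)^2))"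
proof -
  have "(a + b * (\<theta>^2 - 2) + c * (\<theta>^2 - 2)^2) * (a + b * (1 - \<theta> - \<theta>^2) + c * (1 - \<theta> - \<theta>^2)^2)
    = (a^2 - 2 * b^2 + 5 * c^2 - a * b + 5 * a * c + b * c) + (b^2 - c^2 - a * b - b * c) * \<theta>
      + (b^2 - 2 * c^2 - a * c - b * c) * \<theta>^2"
  proof -
    have "(\<theta>^2 - 2)^2 = 3 - \<theta> - \<theta>^2" "(1 - \<theta> - \<theta>^2)^2 = 2 + \<theta>"
      using \<theta>_cube by Groebner_Basis.algebra+
    thus ?thesis using \<theta>_cube by simp Groebner_Basis.algebra
  qed
  thus ?thesis unfolding norm_form_def using \<theta>_cube by simp Groebner_Basis.algebra
qed

text \<open>Modulo \<open>2\<close> the norm form is that of the field with eight elements.\<close>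

lemma even_norm_form_iff:
  fixes p q r :: int
  shows "even (norm_form p q r) \<longleftrightarrow> even p \<and> even q \<and> even r"
  by (cases "even p"; cases "even q"; cases "even r") (simp_all add: norm_form_def)

text \<open>Infinite descent: a relation has norm zero, so by \<open>even_norm_form_iff\<close> all
  its coefficients are even, and halving them gives a smaller relation.\<close>

lemma int_independent:
  fixes p q r :: int
  assumes "of_int p + of_int q * \<theta> + of_int r * \<theta>^2 = 0"
  shows "p = 0 \<and> q = 0 \<and> r = 0"
  using assms
proof (induction "nat (\<bar>p\<bar> + \<bar>q\<bar> + \<bar>r\<bar>)" arbitrary: p q r rule: less_induct)
  case less
  have "complex_of_int (norm_form p q r) = norm_form (of_int p) (of_int q) (of_int r)"
    by (simp add: norm_form_def)
  also have "\<dots> = 0" unfolding norm_form_eq less.prems by simp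
  finally have "norm_form p q r = 0" by simp
  hence "even p" "even q" "even r" using even_norm_form_iff[of p q r] by simp_all
  then obtain p' q' r' where *: "p = 2 * p'" "q = 2 * q'" "r = 2 * r'" by (elim evenE)
  have "2 * (of_int p' + of_int q' * \<theta> + of_int r' * \<theta>^2) = 0"
    using less.prems by (simp only: * of_int_mult of_int_numeral) Groebner_Basis.algebra
  hence zero: "of_int p' + of_int q' * \<theta> + of_int r' * \<theta>^2 = 0"
    unfolding mult_eq_0_iff by simp
  show ?case
  proof (rule ccontr)
    assume "\<not> ?thesis"
    hence "nat (\<bar>p'\<bar> + \<bar>q'\<bar> + \<bar>r'\<bar>) < nat (\<bar>p\<bar> + \<bar>q\<bar> + \<bar>r\<bar>)" by (auto simp: *)
    from less.hyps[OF this zero] \<open>\<not> ?thesis\<close> show False by (simp add: *)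
  qed
qed

lemma rat_independent:
  assumes "p \<in> \<rat>" "q \<in> \<rat>" "r \<in> \<rat>" "p + q * \<theta> + r * \<theta>^2 = 0"
  shows "p = 0 \<and> q = 0 \<and> r = 0"
proof -
  obtain a a' where p: "a' > 0" "p = of_int a / of_int a'" using assms(1) by (rule Rats_cases')
  obtain b b' where q: "b' > 0" "q = of_int b / of_int b'" using assms(2) by (rule Rats_cases')
  obtain c c' where r: "c' > 0" "r = of_int c / of_int c'" using assms(3) by (rule Rats_cases')
  have "of_int (a * b' * c') + of_int (b * a' * c') * \<theta> + of_int (c * a' * b') * \<theta>^2
      = of_int (a' * b' * c') * (p + q * \<theta> + r * \<theta>^2)"
  proof -
    have "of_int a = of_int a' * p" "of_int b = of_int b' * q" "of_int c = of_int c' * r"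
      using p q r by simp_all
    thus ?thesis by (simp only: of_int_mult ring_distribs mult_ac)
  qed
  hence "of_int (a * b' * c') + of_int (b * a' * c') * \<theta> + of_int (c * a' * b') * \<theta>^2 = 0"
    using assms(4) by simp
  from int_independent[OF this] show ?thesis using p q r by simp
qed

text \<open>Since \<open>\<theta>\<close> is real and \<open>j\<close> is not, a relation over Q(j)
  splits into two relations over the rationals.\<close>

lemma Qj_independent:
  assumes "a \<in> Qj" "b \<in> Qj" "c \<in> Qj" "a + b * \<theta> + c * \<theta>^2 = 0"
  shows "a = 0" "b = 0" "c = 0"
proof -
  obtain a0 a1 where a: "a0 \<in> \<rat>" "a1 \<in> \<rat>" "a = a0 + a1 * j" using assms(1) by (rule quad_extE)
  obtain b0 b1 where b: "b0 \<in> \<rat>" "b1 \<in> \<rat>" "b = b0 + b1 * j" using assms(2) by (rule quad_extE)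
  obtain c0 c1 where c: "c0 \<in> \<rat>" "c1 \<in> \<rat>" "c = c0 + c1 * j" using assms(3) by (rule quad_extE)
  have real: "p + q * \<theta> + r * \<theta>^2 \<in> \<real>" if "p \<in> \<rat>" "q \<in> \<rat>" "r \<in> \<rat>" for p q r
    using that \<theta>_real Rats_subset_Reals by (intro Reals_add Reals_mult Reals_power) blast+
  have "(a0 + b0 * \<theta> + c0 * \<theta>^2) + (a1 + b1 * \<theta> + c1 * \<theta>^2) * j = 0"
    using assms(4) by (simp add: a b c algebra_simps)
  note zero = real_j_independent[OF real real this, OF a(1) b(1) c(1) a(2) b(2) c(2)]
  show "a = 0" "b = 0" "c = 0"
    using rat_independent[OF a(1) b(1) c(1) zero(1)] rat_independent[OF a(2) b(2) c(2) zero(2)]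
    by (simp_all add: a b c)
qed

lemma Qj_coords_unique:
  assumes "a \<in> Qj" "b \<in> Qj" "c \<in> Qj" "a' \<in> Qj" "b' \<in> Qj" "c' \<in> Qj"
    "a + b * \<theta> + c * \<theta>^2 = a' + b' * \<theta> + c' * \<theta>^2"
  shows "a = a'" "b = b'" "c = c'"
proof -
  have "(a - a') + (b - b') * \<theta> + (c - c') * \<theta>^2 = 0"
    using assms(7) by (simp add: algebra_simps)
  note zero = Qj_independent[OF Qj_closed(6)[OF assms(1,4)] Qj_closed(6)[OF assms(2,5)]
      Qj_closed(6)[OF assms(3,6)] this]
  show "a = a'" "b = b'" "c = c'" using zero by simp_all
qed

subsection \<open>Identification of the fields\<close>

text \<open>The inverse is the complex conjugate divided by the rational number
  \<open>a^2 - a * b + b^2\<close>.\<close>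

lemma subfield_Qj: "subfield Qj \<C>"
proof (rule subfield_complexI[OF subring_Qj])
  fix x assume "x \<in> Qj" "x \<noteq> 0"
  then obtain a b where x: "a \<in> \<rat>" "b \<in> \<rat>" "x = a + b * j" by (elim quad_extE)
  have cnj: "cnj a = a" "cnj b = b" using x Rats_subset_Reals by (auto simp: Reals_cnj_iff[symmetric])
  have "x * cnj x = a^2 - a * b + b^2"
    using j_square by (simp add: x cnj cnj_j) Groebner_Basis.algebra
  hence *: "x * ((a - b) + (- b) * j) = a^2 - a * b + b^2"
    by (simp add: x cnj cnj_j algebra_simps)
  have ne: "a^2 - a * b + b^2 \<noteq> 0"
    using \<open>x \<noteq> 0\<close> \<open>x * cnj x = _\<close> by (metis complex_cnj_zero_iff mult_eq_0_iff)
  have "x * (inverse (a^2 - a * b + b^2) * ((a - b) + (- b) * j)) = 1"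
    by (simp only: mult.left_commute[of x] * left_inverse[OF ne])
  hence "inverse x = inverse (a^2 - a * b + b^2) * ((a - b) + (- b) * j)" by (rule inverse_unique)
  also have "\<dots> \<in> Qj"
    using x by (intro Qj_closed(4) quad_extI subsetD[OF quad_ext_generators(1)[OF subring_Rats]]) auto
  finally show "inverse x \<in> Qj" .
qed

text \<open>Makes \<open>Qj_independent\<close> available for the conjugates of
  \<open>\<theta>\<close>, so that conjugates of nonzero elements of \<open>K\<close> are seen to be
  nonzero.\<close>

lemma conj_eisenstein_cubic: "eisenstein_cubic j (\<theta>^2 - 2)" "eisenstein_cubic j (1 - \<theta> - \<theta>^2)"
proof (unfold_locales)
  show "(\<theta>^2 - 2)^3 = 1 + 2 * (\<theta>^2 - 2) - (\<theta>^2 - 2)^2"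
    "(1 - \<theta> - \<theta>^2)^3 = 1 + 2 * (1 - \<theta> - \<theta>^2) - (1 - \<theta> - \<theta>^2)^2"
    using \<theta>_cube by Groebner_Basis.algebra+
  show "\<theta>^2 - 2 \<in> \<real>" "1 - \<theta> - \<theta>^2 \<in> \<real>" using \<theta>_real by auto
qed (rule j_square)+

text \<open>The inverse is the product of the other two conjugates divided by the norm, a nonzero
  element of Q(j).\<close>

lemma subfield_K: "subfield K \<C>"
proof (rule subfield_complexI[OF subring_K])
  fix x assume "x \<in> K" "x \<noteq> 0"
  then obtain a b c where abc: "a \<in> Qj" "b \<in> Qj" "c \<in> Qj" and x: "x = a + b * \<theta> + c * \<theta>^2"
    by (elim cubic_extE)
  define x' where "x' = a + b * (\<theta>^2 - 2) + c * (\<theta>^2 - 2)^2"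
  define x'' where "x'' = a + b * (1 - \<theta> - \<theta>^2) + c * (1 - \<theta> - \<theta>^2)^2"
  have norm: "x * (x' * x'') = norm_form a b c" unfolding x x'_def x''_def norm_form_eq ..
  have norm_Qj: "norm_form a b c \<in> Qj" unfolding norm_form_def by (intro Qj_closed abc)
  have nonzero: "a \<noteq> 0 \<or> b \<noteq> 0 \<or> c \<noteq> 0" using \<open>x \<noteq> 0\<close> x by auto
  have "x' \<noteq> 0" "x'' \<noteq> 0"
    unfolding x'_def x''_def
    using eisenstein_cubic.Qj_independent[OF conj_eisenstein_cubic(1) abc]
      eisenstein_cubic.Qj_independent[OF conj_eisenstein_cubic(2) abc] nonzero by blast+
  hence ne: "norm_form a b c \<noteq> 0" using \<open>x \<noteq> 0\<close> norm by (metis mult_eq_0_iff)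
  hence "x * (inverse (norm_form a b c) * (x' * x'')) = 1"
    by (subst mult.left_commute) (simp add: norm)
  hence "inverse x = inverse (norm_form a b c) * (x' * x'')" by (rule inverse_unique)
  also have "\<dots> \<in> K"
  proof -
    have "inverse (norm_form a b c) \<in> Qj"
      using ring.subfield_m_inv(1)[OF ring_complex subfield_Qj, of "norm_form a b c"]
        norm_Qj ne by simp
    thus ?thesis unfolding x'_def x''_def
      using abc Qj_subset_K by (intro K_closed \<theta>_mem) auto
  qed
  finally show "inverse x \<in> K" .
qed

lemma adjoin_j: "adjoin {j} = Qj"
proof
  show "adjoin {j} \<subseteq> Qj"
    using j_mem by (intro field.generate_field_min_subfield1[OF field_complex] subfield_Qj) auto
  have sf: "subfield (adjoin {j}) \<C>" by (rule field.generate_field_is_subfield[OF field_complex]) simp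
  note C = subring_complexD(4,5)[OF subfieldE(1)[OF sf]]
  have "j \<in> adjoin {j}" by (rule generate_field.incl) simp
  thus "Qj \<subseteq> adjoin {j}"
    using Rats_subset_subfield[OF sf] by (auto elim!: quad_extE intro!: C)
qed

lemma adjoin_j_\<theta>: "adjoin {j, \<theta>} = K"
proof
  show "adjoin {j, \<theta>} \<subseteq> K"
    using j_mem \<theta>_mem by (intro field.generate_field_min_subfield1[OF field_complex] subfield_K) auto
  have sf: "subfield (adjoin {j, \<theta>}) \<C>" by (rule field.generate_field_is_subfield[OF field_complex]) simp
  note C = subring_complexD(4,5,7)[OF subfieldE(1)[OF sf]]
  have "Qj \<subseteq> adjoin {j, \<theta>}"
    unfolding adjoin_j[symmetric] by (intro field.mono_generate_field[OF field_complex]) auto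
  moreover have "\<theta> \<in> adjoin {j, \<theta>}" by (rule generate_field.incl) simp
  ultimately show "K \<subseteq> adjoin {j, \<theta>}"
    by (auto elim!: cubic_extE intro!: C)
qed

lemma generate_ring_j: "generate_ring \<C> {j} = Zj"
proof
  show "generate_ring \<C> {j} \<subseteq> Zj"
    using j_mem by (intro ring.generate_ring_min_subring1[OF ring_complex] subring_Zj) auto
  have sr: "subring (generate_ring \<C> {j}) \<C>" by (rule ring.generate_ring_is_subring[OF ring_complex]) simp
  have "j \<in> generate_ring \<C> {j}" by (rule generate_ring.incl) simp
  thus "Zj \<subseteq> generate_ring \<C> {j}"
    using subring_complexD(4,5,9)[OF sr] by (auto elim!: quad_extE Ints_cases)
qed

text \<open>\<open>K\<close> arises from the zero space by three successive line extensions, by 1,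
  \<open>\<theta>\<close> and \<open>\<theta>^2\<close>; independence shows that each one is
  proper.\<close>

lemma dimension_K: "ring.dimension \<C> 3 Qj K"
proof -
  interpret ring \<C> by (rule ring_complex)
  have "line_extension Qj 1 {0} = Qj"
    by (auto simp: line_extension_mem_iff)
  hence 1: "dimension 1 Qj Qj"
    using Suc_dim[of 1 "{\<zero>\<^bsub>\<C>\<^esub>}" 0 Qj] zero_dim[of Qj] by simp
  have \<theta>: "\<theta> \<notin> Qj"
    using Qj_independent(2)[of "- \<theta>" 1 0] Qj_closed(1-3) by auto
  have 2: "dimension 2 Qj (line_extension Qj \<theta> Qj)"
    using Suc_dim[OF _ \<theta> 1] by (simp add: numeral_2_eq_2)
  have \<theta>2: "\<theta>^2 \<notin> line_extension Qj \<theta> Qj"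
  proof
    assume "\<theta>^2 \<in> line_extension Qj \<theta> Qj"
    then obtain b a where ab: "a \<in> Qj" "b \<in> Qj" "\<theta>^2 = b * \<theta> + a"
      by (auto simp: line_extension_mem_iff)
    hence "- a + (- b) * \<theta> + 1 * \<theta>^2 = 0" by (simp add: algebra_simps)
    from Qj_independent(3)[OF Qj_closed(3)[OF ab(1)] Qj_closed(3)[OF ab(2)] Qj_closed(1) this]
    show False by simp
  qed
  have "line_extension Qj (\<theta>^2) (line_extension Qj \<theta> Qj) = K"
    by (force simp: line_extension_mem_iff cubic_ext_def algebra_simps)
  thus ?thesis
    using Suc_dim[OF _ \<theta>2 2] by (simp add: numeral_3_eq_3 numeral_2_eq_2)
qed

end

section \<open>The automorphism \<open>\<theta> \<mapsto> \<theta>\<^sup>2 - 2\<close>\<close>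

text \<open>Prescribing the values on \<open>K\<close> alone lets the locale cover both the map
  constructed in \<open>ex_galois_aut\<close> and any Galois automorphism with the right value at
  \<open>\<theta>\<close>.\<close>

locale eisenstein_cubic_aut = eisenstein_cubic +
  fixes s :: "complex \<Rightarrow> complex"
  assumes s_coords: "a \<in> Qj \<Longrightarrow> b \<in> Qj \<Longrightarrow> c \<in> Qj \<Longrightarrow>
    s (a + b * \<theta> + c * \<theta>^2) = a + b * (\<theta>^2 - 2) + c * (\<theta>^2 - 2)^2"
begin

lemma \<theta>'_square: "(\<theta>^2 - 2)^2 = 3 - \<theta> - \<theta>^2"
  using \<theta>_cube by Groebner_Basis.algebra

lemma s_coords':
  assumes "a \<in> Qj" "b \<in> Qj" "c \<in> Qj"
  shows "s (a + b * \<theta> + c * \<theta>^2) = (a - 2 * b + 3 * c) + (- c) * \<theta> + (b - c) * \<theta>^2"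
  unfolding s_coords[OF assms] \<theta>'_square by Groebner_Basis.algebra

lemma s_Qj [simp]: "a \<in> Qj \<Longrightarrow> s a = a"
  using s_coords[of a 0 0] Qj_closed(2) by simp

lemma s_simps [simp]: "s 1 = 1" "s 0 = 0" "s j = j" "s (numeral n) = numeral n" "s (of_int m) = of_int m"
  by (simp_all add: Qj_closed j_mem)

lemma s_\<theta> [simp]: "s \<theta> = \<theta>^2 - 2"
  using s_coords[of 0 1 0] Qj_closed(1,2) by simp

lemma s_cubic_ext:
  assumes A: "subring A \<C>" "A \<subseteq> Qj" and x: "x \<in> cubic_ext \<theta> A"
  shows "s x \<in> cubic_ext \<theta> A"
proof -
  obtain a b c where abc: "a \<in> A" "b \<in> A" "c \<in> A" "x = a + b * \<theta> + c * \<theta>^2"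
    using x by (rule cubic_extE)
  hence "a \<in> Qj" "b \<in> Qj" "c \<in> Qj" using A(2) by auto
  note s_coords'[OF this]
  moreover have "(a - 2 * b + 3 * c) + (- c) * \<theta> + (b - c) * \<theta>^2 \<in> cubic_ext \<theta> A"
    by (intro cubic_extI subring_complexD(3-6,10)[OF A(1)] abc)
  ultimately show ?thesis unfolding abc(4) by (simp only:)
qed

lemma s_K [simp]: "x \<in> K \<Longrightarrow> s x \<in> K" and s_ZK [simp]: "x \<in> ZK \<Longrightarrow> s x \<in> ZK"
  using s_cubic_ext[OF subring_Qj] s_cubic_ext[OF subring_Zj Zj_subset_Qj] by auto

text \<open>Comparing coordinates gives \<open>b = - c\<close> and \<open>b - c = c\<close>, hence
  \<open>3 * c = 0\<close>. With \<open>A\<close> the field Q(j) this yields the fixed field; with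
  \<open>A\<close> the ring Z[j] it shows that norms from \<open>ZK\<close> lie in Z[j].\<close>

lemma fixed_imp_mem:
  assumes A: "A \<subseteq> Qj" and x: "x \<in> cubic_ext \<theta> A" and "s x = x"
  shows "x \<in> A"
proof -
  obtain a b c where abc: "a \<in> A" "b \<in> A" "c \<in> A" "x = a + b * \<theta> + c * \<theta>^2"
    using x by (rule cubic_extE)
  hence Qj: "a \<in> Qj" "b \<in> Qj" "c \<in> Qj" using A by auto
  have eq: "(a - 2 * b + 3 * c) + (- c) * \<theta> + (b - c) * \<theta>^2 = a + b * \<theta> + c * \<theta>^2"
    using assms(3) unfolding abc(4) s_coords'[OF Qj] .
  have *: "a - 2 * b + 3 * c \<in> Qj" "- c \<in> Qj" "b - c \<in> Qj" by (intro Qj_closed Qj)+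
  note bc = Qj_coords_unique(2,3)[OF * Qj eq]
  have "3 * c = c - (- c - c)" by simp
  also have "\<dots> = 0" using bc by (simp only: diff_self)
  finally have "c = 0" by simp
  hence "c = 0" "b = 0" using bc by simp_all
  thus ?thesis using abc by simp
qed

lemma s_add [simp]:
  assumes "x \<in> K" "y \<in> K"
  shows "s (x + y) = s x + s y"
proof -
  obtain a b c where x: "a \<in> Qj" "b \<in> Qj" "c \<in> Qj" "x = a + b * \<theta> + c * \<theta>^2"
    using assms(1) by (rule cubic_extE)
  obtain d e f where y: "d \<in> Qj" "e \<in> Qj" "f \<in> Qj" "y = d + e * \<theta> + f * \<theta>^2"
    using assms(2) by (rule cubic_extE)
  have "x + y = (a + d) + (b + e) * \<theta> + (c + f) * \<theta>^2"
    unfolding x y by Groebner_Basis.algebra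
  hence "s (x + y) = (a + d) + (b + e) * (\<theta>^2 - 2) + (c + f) * (\<theta>^2 - 2)^2"
    using s_coords[OF Qj_closed(5)[OF x(1) y(1)] Qj_closed(5)[OF x(2) y(2)] Qj_closed(5)[OF x(3) y(3)]] by simp
  thus ?thesis
    unfolding x(4) y(4) s_coords[OF x(1-3)] s_coords[OF y(1-3)] by Groebner_Basis.algebra
qed

lemma s_mult [simp]:
  assumes "x \<in> K" "y \<in> K"
  shows "s (x * y) = s x * s y"
proof -
  obtain a b c where x: "a \<in> Qj" "b \<in> Qj" "c \<in> Qj" "x = a + b * \<theta> + c * \<theta>^2"
    using assms(1) by (rule cubic_extE)
  obtain d e f where y: "d \<in> Qj" "e \<in> Qj" "f \<in> Qj" "y = d + e * \<theta> + f * \<theta>^2"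
    using assms(2) by (rule cubic_extE)
  \<comment> \<open>Coordinates of the product after reducing the powers from
    \<open>\<theta>^3\<close> on. The conjugate \<open>\<theta>^2 - 2\<close> satisfies the same
    cubic, so the same coordinates describe the product of the images.\<close>
  define A B C where "A = (a * d + (b * f + c * e) - c * f)"
    and "B = (a * e + b * d + 2 * (b * f + c * e) - c * f)"
    and "C = (a * f + b * e + c * d - (b * f + c * e) + 3 * (c * f))"
  have Qj: "A \<in> Qj" "B \<in> Qj" "C \<in> Qj"
    unfolding A_def B_def C_def by (intro Qj_closed x y)+
  have "x * y = A + B * \<theta> + C * \<theta>^2"
    unfolding x y A_def B_def C_def using \<theta>_cube by Groebner_Basis.algebra
  hence "s (x * y) = A + B * (\<theta>^2 - 2) + C * (\<theta>^2 - 2)^2"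
    using s_coords[OF Qj] by simp
  also have "\<dots> = (a + b * (\<theta>^2 - 2) + c * (\<theta>^2 - 2)^2) * (d + e * (\<theta>^2 - 2) + f * (\<theta>^2 - 2)^2)"
    unfolding A_def B_def C_def \<theta>'_square using \<theta>_cube by Groebner_Basis.algebra
  finally show ?thesis
    unfolding x(4) y(4) s_coords[OF x(1-3)] s_coords[OF y(1-3)] .
qed

lemma s_minus [simp]: "x \<in> K \<Longrightarrow> s (- x) = - s x"
  using s_add[of "- x" x] K_closed(3)[of x] by (simp add: eq_neg_iff_add_eq_0)

lemma s_diff [simp]: "x \<in> K \<Longrightarrow> y \<in> K \<Longrightarrow> s (x - y) = s x - s y"
  using s_add[of x "- y"] K_closed(3) by simp

lemma s_power [simp]: "x \<in> K \<Longrightarrow> s (x ^ n) = s x ^ n"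
  by (induction n) (simp_all add: K_closed)

lemma s_s_\<theta>: "s (s \<theta>) = 1 - \<theta> - \<theta>^2"
  using \<theta>'_square by (simp add: \<theta>_mem K_closed)

text \<open>The roots are permuted cyclically: \<open>\<theta>\<close> goes to
  \<open>\<theta>^2 - 2\<close>, this to \<open>1 - \<theta> - \<theta>^2\<close>, and this back to
  \<open>\<theta>\<close>.\<close>

lemma s_s_s [simp]:
  assumes "x \<in> K"
  shows "s (s (s x)) = x"
proof -
  obtain a b c where x: "a \<in> Qj" "b \<in> Qj" "c \<in> Qj" "x = a + b * \<theta> + c * \<theta>^2"
    using assms by (rule cubic_extE)
  have K: "a \<in> K" "b \<in> K" "c \<in> K" using x Qj_subset_K by auto
  have \<theta>: "s (1 - \<theta> - \<theta>^2) = \<theta>"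
    using \<theta>'_square by (simp add: \<theta>_mem K_closed)
  show ?thesis
    unfolding x(4) using x K
    by (simp only: s_add s_mult s_power s_Qj s_\<theta> s_s_\<theta>[unfolded s_\<theta>] \<theta> \<theta>_mem K_closed)
qed

lemma s_eq_0_iff: "x \<in> K \<Longrightarrow> s x = 0 \<longleftrightarrow> x = 0"
  by (metis s_s_s s_simps(2))

lemma bij_s: "bij_betw s K K"
  by (rule bij_betw_byWitness[where f' = "s \<circ> s"]) auto

section \<open>Complex conjugation on \<open>K\<close>\<close>

lemma cnj_Qj:
  assumes "a \<in> Qj"
  shows "cnj a \<in> Qj"
proof -
  obtain p q where a: "p \<in> \<rat>" "q \<in> \<rat>" "a = p + q * j" using assms by (rule quad_extE)
  hence "cnj p = p" "cnj q = q" using Rats_subset_Reals by (auto simp: Reals_cnj_iff)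
  hence "cnj a = (p - q) + (- q) * j" by (simp add: a(3) cnj_j algebra_simps)
  also have "\<dots> \<in> Qj" by (intro quad_extI) (use a in auto)
  finally show ?thesis .
qed

text \<open>\<open>\<theta>\<close> and its image are real and \<open>s\<close> fixes Q(j), so
  conjugation commutes with \<open>s\<close>; this allows \<open>s\<close> to be applied to
  Hermitian products.\<close>

lemma cnj_K:
  assumes "x \<in> K"
  shows "cnj x \<in> K" "s (cnj x) = cnj (s x)"
proof -
  obtain a b c where x: "a \<in> Qj" "b \<in> Qj" "c \<in> Qj" "x = a + b * \<theta> + c * \<theta>^2"
    using assms by (rule cubic_extE)
  have cnj: "cnj x = cnj a + cnj b * \<theta> + cnj c * \<theta>^2" by (simp add: x)
  show "cnj x \<in> K" unfolding cnj by (intro cubic_extI cnj_Qj x)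
  show "s (cnj x) = cnj (s x)"
    unfolding cnj s_coords[OF x(1-3)[THEN cnj_Qj]] unfolding x(4) s_coords[OF x(1-3)] by simp
qed

section \<open>Trace and norm from \<open>K\<close> to Q(j)\<close>

definition Tr :: "complex \<Rightarrow> complex" where "Tr x = x + s x + s (s x)"
definition N :: "complex \<Rightarrow> complex" where "N x = x * s x * s (s x)"

lemma s_Tr: "x \<in> K \<Longrightarrow> s (Tr x) = Tr x"
  by (simp add: Tr_def K_closed add_ac)

lemma s_N: "x \<in> K \<Longrightarrow> s (N x) = N x"
  by (simp add: N_def K_closed mult_ac)

lemma Tr_K: "x \<in> K \<Longrightarrow> Tr x \<in> K"
  by (simp add: Tr_def K_closed)

lemma N_K: "x \<in> K \<Longrightarrow> N x \<in> K"
  by (simp add: N_def K_closed)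

lemma Tr_Qj: "x \<in> K \<Longrightarrow> Tr x \<in> Qj"
  by (rule fixed_imp_mem[OF order_refl Tr_K s_Tr])

lemma N_Qj: "x \<in> K \<Longrightarrow> N x \<in> Qj"
  by (rule fixed_imp_mem[OF order_refl N_K s_N])

lemma N_Zj: "x \<in> ZK \<Longrightarrow> N x \<in> Zj"
  by (rule fixed_imp_mem[OF Zj_subset_Qj _ s_N])
     (use ZK_subset_K in \<open>auto simp: N_def ZK_closed\<close>)

lemma N_mult: "x \<in> K \<Longrightarrow> y \<in> K \<Longrightarrow> N (x * y) = N x * N y"
  by (simp add: N_def)

lemma N_eq_0_iff: "x \<in> K \<Longrightarrow> N x = 0 \<longleftrightarrow> x = 0"
  by (auto simp: N_def s_eq_0_iff)

lemma N_coords: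
  assumes "a \<in> Qj" "b \<in> Qj" "c \<in> Qj"
  shows "N (a + b * \<theta> + c * \<theta>^2) = norm_form a b c"
proof -
  let ?x = "a + b * \<theta> + c * \<theta>^2"
  have K: "a \<in> K" "b \<in> K" "c \<in> K" using assms Qj_subset_K by auto
  have "s (s ?x) = a + b * (1 - \<theta> - \<theta>^2) + c * (1 - \<theta> - \<theta>^2)^2"
    using assms K
    by (simp only: s_add s_mult s_power s_Qj s_\<theta> s_s_\<theta>[unfolded s_\<theta>] \<theta>_mem K_closed)
  thus ?thesis unfolding N_def norm_form_eq s_coords[OF assms] by simp
qed

end

section \<open>Integers of \<open>\<rat>(j)\<close>\<close>

context eisenstein_cubic
begin

lemma algebraic_int_j: "algebraic_int j"
proof
  show "lead_coeff [:1, 1, 1 :: complex:] = 1" by simp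
  show "\<forall>i. poly.coeff [:1, 1, 1 :: complex:] i \<in> \<int>" by (auto simp: coeff_pCons split: nat.splits)
  show "poly [:1, 1, 1:] j = 0" using j_square by (simp add: power2_eq_square algebra_simps)
qed

lemma algebraic_int_\<theta>: "algebraic_int \<theta>"
proof
  show "lead_coeff [:-1, -2, 1, 1 :: complex:] = 1" by simp
  show "\<forall>i. poly.coeff [:-1, -2, 1, 1 :: complex:] i \<in> \<int>" by (auto simp: coeff_pCons split: nat.splits)
  have "poly [:-1, -2, 1, 1:] \<theta> = \<theta>^3 + \<theta>^2 - 2 * \<theta> - 1"
    by (simp add: power2_eq_square power3_eq_cube algebra_simps)
  thus "poly [:-1, -2, 1, 1:] \<theta> = 0" using \<theta>_cube by simp
qed

lemma Zj_algebraic_int: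
  assumes "x \<in> Zj"
  shows "algebraic_int x"
proof -
  obtain a b where "a \<in> \<int>" "b \<in> \<int>" "x = a + b * j" using assms by (rule quad_extE)
  thus ?thesis by (simp add: algebraic_int_add algebraic_int_mult algebraic_int_j int_imp_algebraic_int)
qed

lemma ZK_algebraic_int:
  assumes "x \<in> ZK"
  shows "algebraic_int x"
proof -
  obtain a b c where "a \<in> Zj" "b \<in> Zj" "c \<in> Zj" "x = a + b * \<theta> + c * \<theta>^2"
    using assms by (rule cubic_extE)
  thus ?thesis
    by (simp add: power2_eq_square algebraic_int_add algebraic_int_mult algebraic_int_\<theta> Zj_algebraic_int)
qed

text \<open>The traces of \<open>x\<close> and \<open>j * x\<close> and the norm of \<open>x\<close>
  are rational algebraic integers, hence integers. The traces alone control only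
  \<open>3 * a\<close>; the norm removes the factor 3.\<close>

lemma ring_of_integers_Qj: "ring_of_integers Qj = Zj"
proof
  show "Zj \<subseteq> ring_of_integers Qj"
    using Zj_subset_Qj Zj_algebraic_int by (auto simp: ring_of_integers_def)
  show "ring_of_integers Qj \<subseteq> Zj"
  proof
    fix x assume "x \<in> ring_of_integers Qj"
    hence int: "algebraic_int x" and "x \<in> Qj" by (auto simp: ring_of_integers_def)
    from this(2) obtain a b where x: "a \<in> \<rat>" "b \<in> \<rat>" "x = a + b * j" by (rule quad_extE)
    have cnj: "cnj a = a" "cnj b = b" using x Rats_subset_Reals by (auto simp: Reals_cnj_iff)
    have ints: "y \<in> \<int>" if "algebraic_int y" "y \<in> \<rat>" for y :: complex
      using that by (rule rational_algebraic_int_is_int)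
    have "x + cnj x = 2 * a - b" by (simp add: x cnj cnj_j algebra_simps)
    moreover have "algebraic_int (x + cnj x)"
      by (intro algebraic_int_add algebraic_int_cnj int)
    ultimately have "algebraic_int (2 * a - b)" by (simp only:)
    hence t: "2 * a - b \<in> \<int>" by (rule ints) (intro Rats_diff Rats_mult Rats_number_of x)
    have ji: "algebraic_int (j * x)" by (rule algebraic_int_mult[OF algebraic_int_j int])
    have "j * x + cnj (j * x) = - a - b"
      using j_square by (simp add: x cnj cnj_j) Groebner_Basis.algebra
    moreover have "algebraic_int (j * x + cnj (j * x))"
      by (intro algebraic_int_add algebraic_int_cnj ji)
    ultimately have "algebraic_int (- a - b)" by (simp only:)
    hence u: "- a - b \<in> \<int>" by (rule ints) (simp add: x)
    have "x * cnj x = a^2 - a * b + b^2"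
      using j_square by (simp add: x cnj cnj_j) Groebner_Basis.algebra
    moreover have "algebraic_int (x * cnj x)"
      by (intro algebraic_int_mult algebraic_int_cnj int)
    ultimately have "algebraic_int (a^2 - a * b + b^2)" by (simp only:)
    hence n: "a^2 - a * b + b^2 \<in> \<int>" by (rule ints) (simp add: x)
    obtain t' where t': "2 * a - b = of_int t'" using t by (rule Ints_cases)
    obtain u' where u': "- a - b = of_int u'" using u by (rule Ints_cases)
    obtain n' where n': "a^2 - a * b + b^2 = of_int n'" using n by (rule Ints_cases)
    \<comment> \<open>This is \<open>3 * a\<close>. Substitution into the norm makes
      \<open>m^2\<close> divisible by 3, so \<open>a\<close> is an integer, and then so is
      \<open>b = 2 * a - t'\<close>.\<close>
    define m where "m = t' - u'"
    have m: "of_int m = 3 * a" unfolding m_def of_int_diff t'[symmetric] u'[symmetric] by simp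
    have "of_int (m^2) = (of_int (3 * (n' + m * t' - t'^2)) :: complex)"
      unfolding of_int_mult of_int_diff of_int_add of_int_power m n'[symmetric] t'[symmetric] of_int_numeral
      by Groebner_Basis.algebra
    hence "3 dvd m^2" by (simp only: of_int_eq_iff) simp
    hence "3 dvd m" using prime_dvd_power[of "3::int" m 2] by simp
    then obtain k where "m = 3 * k" by (elim dvdE)
    hence a: "a = of_int k" using m by simp
    have "b = 2 * a - (2 * a - b)" by simp
    also have "\<dots> = of_int (2 * k - t')" by (subst t') (simp add: a)
    finally have "b = of_int (2 * k - t')" .
    thus "x \<in> Zj" unfolding x(3) a by (intro quad_extI) simp_all
  qed
qed

text \<open>\<open>7\<close> is unramified in \<open>\<int>[j]\<close>, so \<open>\<int>[j]/7\<close> is reduced.\<close>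

lemma seven_dvd_of_dvd_cube:
  assumes "a \<in> Zj" "w \<in> Zj" "a^3 = 7 * w"
  shows "\<exists>a'\<in>Zj. a = 7 * a'"
proof -
  obtain p' q' where "p' \<in> \<int>" "q' \<in> \<int>" "a = p' + q' * j" using assms(1) by (rule quad_extE)
  then obtain p q where a: "a = of_int p + of_int q * j" by (auto elim!: Ints_cases)
  obtain m' n' where "m' \<in> \<int>" "n' \<in> \<int>" "w = m' + n' * j" using assms(2) by (rule quad_extE)
  then obtain m n where w: "w = of_int m + of_int n * j" by (auto elim!: Ints_cases)
  have "of_int (p^3 + q^3 - 3 * p * q^2 - 7 * m) + of_int (3 * p^2 * q - 3 * p * q^2 - 7 * n) * j = 0"
    using assms(3) j_square unfolding a w by simp Groebner_Basis.algebra
  from real_j_independent[OF _ _ this]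
  have "p^3 + q^3 - 3 * p * q^2 = 7 * m" "3 * p^2 * q - 3 * p * q^2 = 7 * n"
    by (simp_all only: Reals_of_int of_int_eq_0_iff) simp_all
  hence 1: "(p^3 + q^3 - 3 * p * q^2) mod 7 = 0" "(3 * p^2 * q - 3 * p * q^2) mod 7 = 0" by simp_all
  \<comment> \<open>Both conditions depend only on \<open>p\<close> and \<open>q\<close> modulo 7,
    and a check of the 49 residue pairs leaves only the zero pair.\<close>
  define P Q where "P = p mod 7" and "Q = q mod 7"
  have PQ: "[P = p] (mod 7)" "[Q = q] (mod 7)" by (simp_all add: cong_def P_def Q_def)
  have cong_f: "[P^3 + Q^3 - 3 * P * Q^2 = p^3 + q^3 - 3 * p * q^2] (mod 7)"
    and cong_g: "[3 * P^2 * Q - 3 * P * Q^2 = 3 * p^2 * q - 3 * p * q^2] (mod 7)"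
    by (intro cong_add cong_diff cong_mult cong_pow cong_refl PQ)+
  have "(P^3 + Q^3 - 3 * P * Q^2) mod 7 = 0" "(3 * P^2 * Q - 3 * P * Q^2) mod 7 = 0"
    using 1 cong_f cong_g by (simp_all only: cong_def)
  moreover have "P \<in> {0, 1, 2, 3, 4, 5, 6}" "Q \<in> {0, 1, 2, 3, 4, 5, 6}"
    unfolding P_def Q_def by (simp, presburger)+
  ultimately have "P = 0 \<and> Q = 0"
    unfolding insert_iff empty_iff by (elim disjE) simp_all
  hence "7 dvd p" "7 dvd q" by (simp_all add: P_def Q_def mod_eq_0_iff_dvd)
  then obtain p1 q1 where "p = 7 * p1" "q = 7 * q1" by (elim dvdE)
  hence "a = 7 * (of_int p1 + of_int q1 * j)" by (simp add: a)
  moreover have "of_int p1 + of_int q1 * j \<in> Zj" by (intro quad_extI) auto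
  ultimately show ?thesis by blast
qed

end

section \<open>The basis \<open>\<nu>\<close> and the integers of \<open>\<rat>(j, \<theta>)\<close>\<close>

lemma sum_1_3: "(\<Sum>k=1..3. f k) = f 1 + f 2 + f (3::nat)"
  by (simp add: numeral_3_eq_3 numeral_2_eq_2)

lemma less_3_cases: "(r::nat) < 3 \<Longrightarrow> r = 0 \<or> r = 1 \<or> r = 2"
  by auto

context eisenstein_cubic_aut
begin

text \<open>Integer coefficients are fixed by \<open>s\<close>, so \<open>s x\<close> is a root of
  the same monic polynomial as \<open>x\<close>.\<close>

lemma s_algebraic_int:
  assumes "x \<in> K" "algebraic_int x"
  shows "algebraic_int (s x)"
proof -
  obtain p where p: "poly (map_poly of_int p) x = 0" "lead_coeff p = 1"
    using assms(2) algebraic_int_altdef_ipoly by blast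
  have "poly (map_poly of_int p) x \<in> K \<and> s (poly (map_poly of_int p) x) = poly (map_poly of_int p) (s x)"
    by (induction p) (simp_all add: map_poly_pCons K_closed assms)
  hence "poly (map_poly of_int p) (s x) = 0" using p(1) by simp
  thus ?thesis using p(2) algebraic_int_altdef_ipoly by blast
qed

lemma Tr_integral:
  assumes "x \<in> K" "algebraic_int x"
  shows "Tr x \<in> Zj"
proof -
  have "algebraic_int (Tr x)"
    unfolding Tr_def by (intro algebraic_int_add s_algebraic_int s_K assms)
  thus ?thesis using Tr_Qj[OF assms(1)] ring_of_integers_Qj by (auto simp: ring_of_integers_def)
qed

lemma N_integral:
  assumes "x \<in> K" "algebraic_int x"
  shows "N x \<in> Zj"
proof -
  have "algebraic_int (N x)"
    unfolding N_def by (intro algebraic_int_mult s_algebraic_int s_K assms)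
  thus ?thesis using N_Qj[OF assms(1)] ring_of_integers_Qj by (auto simp: ring_of_integers_def)
qed

text \<open>\<open>t = \<theta> - 2\<close> is a root of the Eisenstein polynomial \<open>t\<^sup>3 + 7t\<^sup>2 + 14t + 7\<close>, so a norm
  divisible by \<open>343\<close> forces all coordinates with respect to \<open>1, t, t\<^sup>2\<close> to be divisible by \<open>7\<close>.\<close>

lemma seven_mult_integral:
  assumes x: "x \<in> K" "algebraic_int x" and "7 * x \<in> ZK"
  shows "x \<in> ZK"
proof -
  obtain a b c where abc: "a \<in> Zj" "b \<in> Zj" "c \<in> Zj" "7 * x = a + b * \<theta> + c * \<theta>^2"
    using assms(3) by (rule cubic_extE)
  \<comment> \<open>\<open>A\<close>, \<open>B\<close>, \<open>c\<close> are the coordinates of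
    \<open>7 * x\<close> with respect to the powers of \<open>t = \<theta> - 2\<close>.\<close>
  define A B where "A = a + 2 * b + 4 * c" and "B = b + 4 * c"
  have AB: "A \<in> Zj" "B \<in> Zj" unfolding A_def B_def by (intro Zj_closed abc)+
  obtain n where n: "n \<in> Zj" "N x = n" using N_integral[OF x] by blast
  have "norm_form a b c = N (7 * x)"
    unfolding abc(4) using abc Zj_subset_Qj by (intro N_coords[symmetric]) auto
  also have "\<dots> = 343 * n"
    using n x by (simp add: N_mult K_closed) (simp add: N_def)
  finally have norm: "norm_form a b c = 343 * n" .
  have ab: "b = B - 4 * c" "a = A - 2 * B + 4 * c"
    unfolding A_def B_def by simp_all
  \<comment> \<open>In these coordinates all terms of the norm form except \<open>A^3\<close> have
    coefficients divisible by 7. Substituting \<open>A = 7 * A'\<close> and cancelling 7 isolates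
    \<open>B^3\<close> in the same way, and one more round isolates \<open>c^3\<close>.\<close>
  have A_cube: "A^3 = 7 * (49 * n + B^3 - 7 * c^3 + A^2 * B - 3 * A^2 * c - 2 * A * B^2 - 7 * B^2 * c
      - 14 * A * c^2 + 14 * B * c^2 + 11 * A * B * c)"
    using norm unfolding norm_form_def ab by Groebner_Basis.algebra
  have "\<exists>A'\<in>Zj. A = 7 * A'"
    by (rule seven_dvd_of_dvd_cube[OF AB(1) _ A_cube]) (intro Zj_closed n AB abc)
  then obtain A' where A': "A' \<in> Zj" "A = 7 * A'" by blast
  have B_cube: "B^3 = 7 * (- 7 * n + 7 * A'^3 + c^3 - 7 * A'^2 * B + 21 * A'^2 * c + 2 * A' * B^2 + B^2 * c
      + 14 * A' * c^2 - 2 * B * c^2 - 11 * A' * B * c)"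
    using norm unfolding norm_form_def ab A'(2) by Groebner_Basis.algebra
  have "\<exists>B'\<in>Zj. B = 7 * B'"
    by (rule seven_dvd_of_dvd_cube[OF AB(2) _ B_cube]) (intro Zj_closed n A' AB abc)
  then obtain B' where B': "B' \<in> Zj" "B = 7 * B'" by blast
  have c_cube: "c^3 = 7 * (n - A'^3 + 7 * B'^3 + 7 * A'^2 * B' - 3 * A'^2 * c - 14 * A' * B'^2 - 7 * B'^2 * c
      - 2 * A' * c^2 + 2 * B' * c^2 + 11 * A' * B' * c)"
    using norm unfolding norm_form_def ab A'(2) B'(2) by Groebner_Basis.algebra
  have "\<exists>c'\<in>Zj. c = 7 * c'"
    by (rule seven_dvd_of_dvd_cube[OF abc(3) _ c_cube]) (intro Zj_closed n A' B' abc)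
  then obtain c' where c': "c' \<in> Zj" "c = 7 * c'" by blast
  have "7 * x = 7 * ((A' - 2 * B' + 4 * c') + (B' - 4 * c') * \<theta> + c' * \<theta>^2)"
    unfolding abc(4) ab A'(2) B'(2) c'(2) by Groebner_Basis.algebra
  hence "x = (A' - 2 * B' + 4 * c') + (B' - 4 * c') * \<theta> + c' * \<theta>^2"
    by (simp only: Rings.mult_cancel_left) simp
  also have "\<dots> \<in> ZK" by (intro cubic_extI Zj_closed A' B' c')
  finally show ?thesis .
qed

end

locale septic_code = eisenstein_cubic_aut +
  fixes \<nu> :: "nat \<Rightarrow> complex"
  assumes \<nu>_1: "\<nu> 1 = (1 + j) + \<theta>"
    and \<nu>_2: "\<nu> 2 = (- 1 - 2 * j) + j * \<theta>^2"
    and \<nu>_3: "\<nu> 3 = (- 1 - 2 * j) + (1 + j) * \<theta> + (1 + j) * \<theta>^2"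
begin

lemma \<nu>_ZK:
  assumes "k \<in> {1..3}"
  shows "\<nu> k \<in> ZK"
proof -
  have "k = 1 \<or> k = 2 \<or> k = 3" using assms by auto
  thus ?thesis
    by (elim disjE) (simp_all only: \<nu>_1 \<nu>_2 \<nu>_3 ZK_closed j_mem \<theta>_mem)
qed

lemma \<nu>_K: "k \<in> {1..3} \<Longrightarrow> \<nu> k \<in> K"
  using \<nu>_ZK ZK_subset_K by blast

lemma s_\<nu>:
  "s (\<nu> 1) = - 1 + j + \<theta>^2"
  "s (\<nu> 2) = - 1 + j - j * \<theta> - j * \<theta>^2"
  "s (\<nu> 3) = - j - (1 + j) * \<theta>"
  unfolding \<nu>_1 \<nu>_2 \<nu>_3
  by (simp_all only: s_add s_diff s_minus s_mult s_power s_simps s_\<theta> \<theta>'_square K_closed j_mem \<theta>_mem)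
     Groebner_Basis.algebra+

lemma s_s_\<nu>:
  "s (s (\<nu> 1)) = 2 + j - \<theta> - \<theta>^2"
  "s (s (\<nu> 2)) = - 1 + j * \<theta>"
  "s (s (\<nu> 3)) = 2 + j - (1 + j) * \<theta>^2"
  unfolding s_\<nu>
  by (simp_all only: s_add s_diff s_minus s_mult s_power s_simps s_\<theta> \<theta>'_square K_closed j_mem \<theta>_mem)
     Groebner_Basis.algebra+

lemma gram_0:
  "(\<Sum>k=1..3. \<nu> k * cnj (\<nu> k)) = 7"
  "(\<Sum>k=1..3. s (\<nu> k) * cnj (\<nu> k)) = 0"
  "(\<Sum>k=1..3. s (s (\<nu> k)) * cnj (\<nu> k)) = 0"
  unfolding sum_1_3 unfolding s_s_\<nu> unfolding s_\<nu> unfolding \<nu>_1 \<nu>_2 \<nu>_3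
    complex_cnj_add complex_cnj_diff complex_cnj_minus complex_cnj_mult complex_cnj_power
    complex_cnj_one complex_cnj_numeral cnj_j cnj_\<theta>
  using j_square \<theta>_cube by Groebner_Basis.algebra+

text \<open>The products with row 0 are computed in \<open>gram_0\<close>. Applying \<open>s\<close>
  to them shifts both row indices, and complex conjugation exchanges the rows; this yields all nine
  entries.\<close>

lemma gram:
  assumes "r < 3" "r' < 3"
  shows "(\<Sum>k=1..3. (s ^^ r) (\<nu> k) * cnj ((s ^^ r') (\<nu> k))) = (if r = r' then 7 else 0)"
proof -
  have K: "\<nu> 1 \<in> K" "\<nu> 2 \<in> K" "\<nu> 3 \<in> K" by (auto intro: \<nu>_K)
  note simps = sum_1_3 K_closed K K[THEN cnj_K(1)] K[THEN cnj_K(2)]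
    K[THEN s_K, THEN cnj_K(1)] K[THEN s_K, THEN cnj_K(2)]
  have 1: "(\<Sum>k=1..3. s (\<nu> k) * cnj (s (\<nu> k))) = 7"
    using arg_cong[OF gram_0(1), of s] by (simp add: simps del: One_nat_def)
  have 2: "(\<Sum>k=1..3. s (s (\<nu> k)) * cnj (s (s (\<nu> k)))) = 7"
    using arg_cong[OF 1, of s] by (simp add: simps del: One_nat_def)
  have 3: "(\<Sum>k=1..3. s (s (\<nu> k)) * cnj (s (\<nu> k))) = 0"
    using arg_cong[OF gram_0(2), of s] by (simp add: simps del: One_nat_def)
  have flip: "(\<Sum>k=1..3. f k * cnj (g k)) = 0" if "(\<Sum>k=1..3. g k * cnj (f k)) = 0"
    for f g :: "nat \<Rightarrow> complex"
  proof -
    have "(\<Sum>k=1..3. f k * cnj (g k)) = cnj (\<Sum>k=1..3. g k * cnj (f k))" by (simp add: mult.commute)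
    also have "\<dots> = 0" unfolding that by simp
    finally show ?thesis .
  qed
  show ?thesis
    using less_3_cases[OF assms(1)] less_3_cases[OF assms(2)]
      gram_0 1 2 3 flip[OF gram_0(2)] flip[OF gram_0(3)] flip[OF 3]
    by (elim disjE) (simp_all add: numeral_2_eq_2)
qed

text \<open>The elements \<open>cnj (\<nu> k) / 7\<close> form the dual basis for the trace form.
  After expanding \<open>Tr\<close>, the relations \<open>gram_0\<close> kill the contributions of
  \<open>s x\<close> and \<open>s (s x)\<close> and leave 7 times \<open>x\<close>.\<close>

lemma trace_expansion:
  assumes "x \<in> K"
  shows "7 * x = (\<Sum>k=1..3. Tr (x * cnj (\<nu> k)) * \<nu> k)"
proof -
  have flip: "(\<Sum>k=1..3. cnj (f k) * \<nu> k) = cnj (\<Sum>k=1..3. f k * cnj (\<nu> k))" for f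
    by simp
  have Tr: "Tr (x * cnj (\<nu> k)) = x * cnj (\<nu> k) + s x * cnj (s (\<nu> k)) + s (s x) * cnj (s (s (\<nu> k)))"
    if "k \<in> {1..3}" for k
    using assms \<nu>_K[OF that] by (simp add: Tr_def cnj_K)
  have "(\<Sum>k=1..3. Tr (x * cnj (\<nu> k)) * \<nu> k) =
    (\<Sum>k=1..3. x * (cnj (\<nu> k) * \<nu> k) + s x * (cnj (s (\<nu> k)) * \<nu> k) + s (s x) * (cnj (s (s (\<nu> k))) * \<nu> k))"
    by (intro sum.cong refl) (simp only: Tr ring_distribs mult.assoc)
  also have "\<dots> = x * (\<Sum>k=1..3. cnj (\<nu> k) * \<nu> k) + s x * (\<Sum>k=1..3. cnj (s (\<nu> k)) * \<nu> k)
      + s (s x) * (\<Sum>k=1..3. cnj (s (s (\<nu> k))) * \<nu> k)"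
    by (simp only: sum.distrib sum_distrib_left)
  also have "\<dots> = 7 * x" unfolding flip gram_0 by simp
  finally show ?thesis by simp
qed

lemma ring_of_integers_K: "ring_of_integers K = ZK"
proof
  show "ZK \<subseteq> ring_of_integers K"
    using ZK_subset_K ZK_algebraic_int by (auto simp: ring_of_integers_def)
  show "ring_of_integers K \<subseteq> ZK"
  proof
    fix x assume "x \<in> ring_of_integers K"
    hence x: "x \<in> K" "algebraic_int x" by (auto simp: ring_of_integers_def)
    have "Tr (x * cnj (\<nu> k)) \<in> ZK" if k: "k \<in> {1..3}" for k
    proof -
      have "algebraic_int (x * cnj (\<nu> k))"
        by (intro algebraic_int_mult algebraic_int_cnj x ZK_algebraic_int \<nu>_ZK k)
      moreover have "x * cnj (\<nu> k) \<in> K" by (intro K_closed cnj_K x \<nu>_K k)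
      ultimately show ?thesis using Tr_integral Zj_subset_ZK by blast
    qed
    hence "7 * x \<in> ZK"
      unfolding trace_expansion[OF x(1)]
      by (intro subring_complexD(11)[OF subring_ZK] ZK_closed \<nu>_ZK)
    thus "x \<in> ZK" by (rule seven_mult_integral[OF x])
  qed
qed

text \<open>\<open>\<nu>\<^sub>k = \<nu>\<^sub>1 w\<^sub>k\<close>, where \<open>w = (1, \<theta>\<^sup>2 - 2, \<theta>\<^sup>2 + \<theta> - 2)\<close> is a basis of \<open>\<int>[j, \<theta>]\<close> over \<open>\<int>[j]\<close>.\<close>

lemma sum_\<nu>:
  "(\<Sum>k=1..3. u k * \<nu> k) =
     ((u 1 - 2 * u 2 - 2 * u 3) + u 3 * \<theta> + (u 2 + u 3) * \<theta>^2) * (1 + j + \<theta>)"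
proof -
  have "\<nu> 2 = (\<theta>^2 - 2) * (1 + j + \<theta>)" "\<nu> 3 = (\<theta>^2 + \<theta> - 2) * (1 + j + \<theta>)"
    unfolding \<nu>_2 \<nu>_3 using \<theta>_cube by Groebner_Basis.algebra+
  moreover have "p * x + q * ((\<theta>^2 - 2) * x) + r * ((\<theta>^2 + \<theta> - 2) * x) =
      ((p - 2 * q - 2 * r) + r * \<theta> + (q + r) * \<theta>^2) * x" for p q r x
    by Groebner_Basis.algebra
  ultimately show ?thesis unfolding sum_1_3 \<nu>_1 by (simp only:)
qed

lemma \<alpha>_nonzero: "1 + j + \<theta> \<noteq> 0"
proof
  assume "1 + j + \<theta> = 0"
  hence "(1 + j) + 1 * \<theta> + 0 * \<theta>^2 = 0" by simp
  from Qj_independent(2)[OF _ _ _ this] show False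
    by (simp add: Qj_closed j_mem)
qed

text \<open>By \<open>sum_\<nu>\<close> the combination is the generator times an element whose
  coordinates depend on \<open>u\<close> through a unimodular matrix over Z[j].\<close>

lemma is_basis_\<nu>: "is_basis Zj 3 \<nu> (PIdl\<^bsub>subring_of ZK\<^esub> (1 + j + \<theta>))"
  unfolding is_basis_def
proof
  have PIdl: "PIdl\<^bsub>subring_of ZK\<^esub> (1 + j + \<theta>) = {x * (1 + j + \<theta>) | x. x \<in> ZK}"
    by (simp add: cgenideal_def)
  show "{\<Sum>k=1..3. u k * \<nu> k |u. \<forall>k\<in>{1..3}. u k \<in> Zj} = PIdl\<^bsub>subring_of ZK\<^esub> (1 + j + \<theta>)"
  proof (intro equalityI subsetI)
    fix y assume "y \<in> {\<Sum>k=1..3. u k * \<nu> k |u. \<forall>k\<in>{1..3}. u k \<in> Zj}"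
    then obtain u where u: "\<forall>k\<in>{1..3}. u k \<in> Zj" "y = (\<Sum>k=1..3. u k * \<nu> k)" by blast
    hence "u 1 \<in> Zj" "u 2 \<in> Zj" "u 3 \<in> Zj" by auto
    hence "(u 1 - 2 * u 2 - 2 * u 3) + u 3 * \<theta> + (u 2 + u 3) * \<theta>^2 \<in> ZK"
      by (intro cubic_extI Zj_closed)
    thus "y \<in> PIdl\<^bsub>subring_of ZK\<^esub> (1 + j + \<theta>)" unfolding PIdl u(2) sum_\<nu> by blast
  next
    fix y assume "y \<in> PIdl\<^bsub>subring_of ZK\<^esub> (1 + j + \<theta>)"
    then obtain x where x: "x \<in> ZK" "y = x * (1 + j + \<theta>)" unfolding PIdl by blast
    from x(1) obtain a b c where abc: "a \<in> Zj" "b \<in> Zj" "c \<in> Zj" "x = a + b * \<theta> + c * \<theta>^2"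
      by (rule cubic_extE)
    \<comment> \<open>Inverts the coordinate change of \<open>sum_\<nu>\<close>, solving
      \<open>u 3 = b\<close>, \<open>u 2 + u 3 = c\<close> and
      \<open>u 1 - 2 * u 2 - 2 * u 3 = a\<close>.\<close>
    define u where "u k = (if k = 1 then a + 2 * c else if k = 2 then c - b else b)" for k :: nat
    have "y = (\<Sum>k=1..3. u k * \<nu> k)"
      unfolding sum_\<nu> x(2) abc(4) u_def by simp
    moreover have "\<forall>k\<in>{1..3}. u k \<in> Zj"
      unfolding u_def by (simp add: Zj_closed abc)
    ultimately show "y \<in> {\<Sum>k=1..3. u k * \<nu> k |u. \<forall>k\<in>{1..3}. u k \<in> Zj}" by blast
  qed
  show "\<forall>u. (\<forall>k\<in>{1..3}. u k \<in> Zj) \<and> (\<Sum>k=1..3. u k * \<nu> k) = 0 \<longrightarrow> (\<forall>k\<in>{1..3}. u k = 0)"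
  proof (intro allI impI, elim conjE)
    fix u assume "\<forall>k\<in>{1..3}. u k \<in> Zj" and zero: "(\<Sum>k=1..3. u k * \<nu> k) = 0"
    hence u: "u 1 \<in> Qj" "u 2 \<in> Qj" "u 3 \<in> Qj" using Zj_subset_Qj by auto
    have "(u 1 - 2 * u 2 - 2 * u 3) + u 3 * \<theta> + (u 2 + u 3) * \<theta>^2 = 0"
      using zero \<alpha>_nonzero unfolding sum_\<nu> mult_eq_0_iff by blast
    from Qj_independent[OF _ _ _ this] u
    have "u 1 - 2 * u 2 - 2 * u 3 = 0" "u 3 = 0" "u 2 + u 3 = 0"
      by (simp_all only: Qj_closed)
    hence "u 1 = 0" "u 2 = 0" "u 3 = 0" by simp_all
    moreover have "k \<in> {1..3} \<Longrightarrow> k = 1 \<or> k = 2 \<or> k = 3" for k :: nat by auto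
    ultimately show "\<forall>k\<in>{1..3}. u k = 0" by blast
  qed
qed

text \<open>The two factors \<open>1 / sqrt 7\<close> turn \<open>gram\<close> into orthonormality
  of the rows, and for a square matrix this gives the other product as well.\<close>

lemma unitary_layer_encoding_matrix: "unitary_mat (layer_encoding_matrix 3 s \<nu> 7)"
proof -
  define R where "R = layer_encoding_matrix 3 s \<nu> 7"
  have R: "R \<in> carrier_mat 3 3" by (simp add: R_def layer_encoding_matrix_def)
  have R_index: "R $$ (r, k) = complex_of_real (1 / sqrt 7) * (s ^^ r) (\<nu> (k + 1))" if "r < 3" "k < 3" for r k
    using that by (simp add: R_def layer_encoding_matrix_def)
  have adj: "mat_adjoint R \<in> carrier_mat 3 3" using R by (intro carrier_matI) (simp_all add: mat_adjoint_def)
  have adj_index: "mat_adjoint R $$ (k, r) = cnj (R $$ (r, k))" if "r < 3" "k < 3" for r k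
    using R that by (simp add: mat_adjoint_def mat_of_rows_def)
  have "R * mat_adjoint R = 1\<^sub>m 3"
  proof (rule eq_matI)
    fix r r' assume "r < dim_row (1\<^sub>m 3 :: complex mat)" "r' < dim_col (1\<^sub>m 3 :: complex mat)"
    hence r: "r < 3" "r' < 3" by simp_all
    have sq: "complex_of_real (1 / sqrt 7) * complex_of_real (1 / sqrt 7) = 1 / 7"
      by (simp flip: of_real_mult)
    have "(R * mat_adjoint R) $$ (r, r') = (\<Sum>k<3. R $$ (r, k) * mat_adjoint R $$ (k, r'))"
      using R adj r by (simp add: scalar_prod_def atLeast0LessThan)
    also have "\<dots> = (\<Sum>k<3. (1 / 7) * ((s ^^ r) (\<nu> (k + 1)) * cnj ((s ^^ r') (\<nu> (k + 1)))))"
    proof (intro sum.cong refl)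
      fix k :: nat assume "k \<in> {..<3}"
      hence k: "k < 3" by simp
      show "R $$ (r, k) * mat_adjoint R $$ (k, r') =
          (1 / 7) * ((s ^^ r) (\<nu> (k + 1)) * cnj ((s ^^ r') (\<nu> (k + 1))))"
        unfolding sq[symmetric] adj_index[OF r(2) k] R_index[OF r(1) k] R_index[OF r(2) k]
          complex_cnj_mult complex_cnj_complex_of_real by (simp only: mult_ac)
    qed
    also have "\<dots> = (1 / 7) * (\<Sum>k<3. (s ^^ r) (\<nu> (k + 1)) * cnj ((s ^^ r') (\<nu> (k + 1))))"
      by (simp only: sum_distrib_left)
    also have "(\<Sum>k<3. (s ^^ r) (\<nu> (k + 1)) * cnj ((s ^^ r') (\<nu> (k + 1)))) =
        (\<Sum>k=1..3. (s ^^ r) (\<nu> k) * cnj ((s ^^ r') (\<nu> k)))"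
      by (simp add: sum_1_3 numeral_3_eq_3 numeral_2_eq_2)
    also have "\<dots> = (if r = r' then 7 else 0)" by (rule gram[OF r])
    finally show "(R * mat_adjoint R) $$ (r, r') = 1\<^sub>m 3 $$ (r, r')"
      using r by (cases "r = r'") simp_all
  qed (use R adj in auto)
  moreover from this have "mat_adjoint R * R = 1\<^sub>m 3"
    by (rule mat_mult_left_right_inverse[OF R adj])
  ultimately show ?thesis using R unfolding R_def[symmetric] by (simp add: unitary_mat_def)
qed

end

section \<open>The reduced norm form has no zeros\<close>

context eisenstein_cubic_aut
begin

text \<open>The determinant of an unscaled codeword with first row \<open>(x, y, z)\<close>, for \<open>\<gamma> = j\<close>.\<close>

definition red_norm :: "complex \<Rightarrow> complex \<Rightarrow> complex \<Rightarrow> complex" where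
  "red_norm x y z = N x + j * N y + j^2 * N z - j * Tr (x * s y * s (s z))"

lemma Tr_Zj: "x \<in> ZK \<Longrightarrow> Tr x \<in> Zj"
  using Tr_integral ZK_subset_K ZK_algebraic_int by blast

lemma red_norm_Zj: "x \<in> ZK \<Longrightarrow> y \<in> ZK \<Longrightarrow> z \<in> ZK \<Longrightarrow> red_norm x y z \<in> Zj"
  unfolding red_norm_def by (intro Zj_closed N_Zj Tr_Zj ZK_closed s_ZK j_mem)

text \<open>\<open>\<beta>\<close> generates a prime ideal of norm \<open>7\<close> which is totally ramified over \<open>\<rat>(j)\<close>;
  \<open>j\<close> and \<open>\<theta>\<close> are both congruent to \<open>2\<close> modulo \<open>\<beta>\<close>.\<close>

definition \<beta> :: complex where "\<beta> = \<theta> - j"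

definition P :: "complex set" where "P = (\<lambda>y. \<beta> * y) ` ZK"

lemma \<beta>_mem: "\<beta> \<in> ZK" "\<beta> \<in> K"
  unfolding \<beta>_def by (intro ZK_closed K_closed j_mem \<theta>_mem)+

lemma P_I: "y \<in> ZK \<Longrightarrow> x = \<beta> * y \<Longrightarrow> x \<in> P"
  by (auto simp: P_def)

lemma P_add: "x \<in> P \<Longrightarrow> y \<in> P \<Longrightarrow> x + y \<in> P"
  by (auto simp: P_def simp flip: distrib_left intro!: imageI ZK_closed(5))

lemma P_mult:
  assumes "a \<in> ZK" "x \<in> P"
  shows "a * x \<in> P"
proof -
  obtain y where "y \<in> ZK" "x = \<beta> * y" using assms(2) by (auto simp: P_def)
  thus ?thesis by (intro P_I[of "a * y"] ZK_closed assms) simp_all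
qed

lemma P_minus: "x \<in> P \<Longrightarrow> - x \<in> P"
  using P_mult[of "- 1" x] ZK_closed(1,3) by simp

lemma P_diff: "x \<in> P \<Longrightarrow> y \<in> P \<Longrightarrow> x - y \<in> P"
  using P_add[of x "- y"] P_minus[of y] by simp

lemma P_0: "0 \<in> P"
  by (rule P_I[of 0]) (simp_all add: ZK_closed)

lemma j_cong_2: "j - 2 \<in> P"
proof (rule P_I)
  \<comment> \<open>The cofactor is \<open>- j^2\<close> times the product of the other two
    conjugates of \<open>\<beta>\<close>, because \<open>j - 2 = - j^2 * N \<beta>\<close>.\<close>
  show "(- 3 - 3 * j) + j * \<theta> + (1 + j) * \<theta>^2 \<in> ZK" by (intro cubic_extI Zj_closed j_mem)
  show "j - 2 = \<beta> * ((- 3 - 3 * j) + j * \<theta> + (1 + j) * \<theta>^2)"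
    unfolding \<beta>_def using j_square \<theta>_cube by Groebner_Basis.algebra
qed

lemma \<theta>_cong_2: "\<theta> - 2 \<in> P"
proof -
  have "\<beta> \<in> P" by (rule P_I[of 1]) (simp_all add: ZK_closed)
  from P_add[OF this j_cong_2] show ?thesis by (simp add: \<beta>_def)
qed

text \<open>\<open>s \<beta> = (\<theta>^2 - 4) - (j - 2)\<close> lies in \<open>P\<close> because
  \<open>\<theta>\<close> and \<open>j\<close> are both 2 modulo \<open>P\<close>.\<close>

lemma s_P:
  assumes "x \<in> P"
  shows "s x \<in> P"
proof -
  obtain y where y: "y \<in> ZK" "x = \<beta> * y" using assms by (auto simp: P_def)
  hence K: "y \<in> K" using ZK_subset_K by auto
  have "s \<beta> = (\<theta> + 2) * (\<theta> - 2) - (j - 2)"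
    unfolding \<beta>_def by (simp add: j_mem \<theta>_mem power2_eq_square algebra_simps)
  also have "\<dots> \<in> P" by (intro P_diff P_mult j_cong_2 \<theta>_cong_2 ZK_closed \<theta>_mem)
  finally have "s y * s \<beta> \<in> P" by (intro P_mult s_ZK y)
  thus ?thesis using K \<beta>_mem by (simp add: y mult.commute)
qed

lemma seven_P: "7 \<in> P"
proof -
  have "7 = (- (j + 3)) * (j - 2)" using j_square by Groebner_Basis.algebra
  also have "\<dots> \<in> P" by (intro P_mult j_cong_2 ZK_closed j_mem)
  finally show ?thesis .
qed

lemma N_\<beta>: "N \<beta> = 1 + 3 * j"
proof -
  have "N ((- j) + 1 * \<theta> + 0 * \<theta>^2) = norm_form (- j) 1 0"
    by (intro N_coords Qj_closed j_mem)
  also have "\<dots> = 1 + 3 * j"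
    using j_square by (simp add: norm_form_def) Groebner_Basis.algebra
  finally show ?thesis by (simp add: \<beta>_def)
qed

text \<open>Taking norms in \<open>n = \<beta> * y\<close> makes \<open>n^3\<close> a multiple of
  \<open>1 + 3 * j\<close>, a prime of Z[j] above 7. This reduces questions modulo \<open>P\<close>
  to rational integers modulo 7.\<close>

lemma of_int_P_iff: "of_int n \<in> P \<longleftrightarrow> 7 dvd n"
proof
  assume "7 dvd n"
  then obtain k where "n = 7 * k" by (elim dvdE)
  thus "of_int n \<in> P" using P_mult[OF ZK_closed(9)[of k] seven_P] by (simp add: mult.commute)
next
  assume "of_int n \<in> P"
  then obtain y where y: "y \<in> ZK" "of_int n = \<beta> * y" by (auto simp: P_def)
  have yK: "y \<in> K" using y ZK_subset_K by auto
  obtain p' q' where "p' \<in> \<int>" "q' \<in> \<int>" "N y = p' + q' * j" using N_Zj[OF y(1)] by (rule quad_extE)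
  then obtain p q where pq: "N y = of_int p + of_int q * j" by (auto elim!: Ints_cases)
  have "of_int n ^ 3 = N (of_int n)" by (simp add: N_def power3_eq_cube)
  also have "\<dots> = N \<beta> * N y" unfolding y(2) by (rule N_mult[OF \<beta>_mem(2) yK])
  also have "\<dots> = (1 + 3 * j) * (of_int p + of_int q * j)" unfolding N_\<beta> pq ..
  finally have n: "of_int n ^ 3 = (1 + 3 * j) * (of_int p + of_int q * j)" .
  have "of_int (n^3 - p + 3 * q) + of_int (2 * q - 3 * p) * j = 0"
    using n j_square by simp Groebner_Basis.algebra
  from real_j_independent[OF _ _ this] have "n^3 - p + 3 * q = 0" "2 * q - 3 * p = 0"
    by (simp_all only: Reals_of_int of_int_eq_0_iff)
  \<comment> \<open>Eliminates \<open>p\<close> from the two coordinate equations.\<close>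
  hence "3 * n^3 = 7 * (- q)" by simp
  hence "7 dvd 3 * n^3" by (metis dvd_triv_left)
  hence "7 dvd n^3" using prime_dvd_mult_iff[of "7::int" 3 "n^3"] by simp
  thus "7 dvd n" using prime_dvd_power[of "7::int" n 3] by simp
qed

text \<open>Congruence modulo the ideal \<open>P\<close>. Membership of both sides in
  \<open>ZK\<close> is built in, so that congruences multiply without side conditions.\<close>

definition pcong :: "complex \<Rightarrow> complex \<Rightarrow> bool" where
  "pcong x y \<longleftrightarrow> x \<in> ZK \<and> y \<in> ZK \<and> x - y \<in> P"

lemma pcong_refl: "x \<in> ZK \<Longrightarrow> pcong x x"
  by (simp add: pcong_def P_0)

lemma pcong_add: "pcong x y \<Longrightarrow> pcong x' y' \<Longrightarrow> pcong (x + x') (y + y')"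
  using P_add[of "x - y" "x' - y'"] by (simp add: pcong_def ZK_closed algebra_simps)

lemma pcong_diff: "pcong x y \<Longrightarrow> pcong x' y' \<Longrightarrow> pcong (x - x') (y - y')"
  using P_diff[of "x - y" "x' - y'"] by (simp add: pcong_def ZK_closed algebra_simps)

lemma pcong_mult:
  assumes "pcong x y" "pcong x' y'"
  shows "pcong (x * x') (y * y')"
proof -
  have "x * x' - y * y' = x' * (x - y) + y * (x' - y')" by (simp add: algebra_simps)
  also have "\<dots> \<in> P" using assms by (intro P_add P_mult) (auto simp: pcong_def)
  finally show ?thesis using assms by (simp add: pcong_def ZK_closed)
qed

text \<open>\<open>P\<close> is stable under \<open>s\<close> and integers are fixed by it, so all
  conjugates have the same residue.\<close>

lemma pcong_s:
  assumes "pcong x (of_int n)"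
  shows "pcong (s x) (of_int n)"
proof -
  have "x \<in> K" using assms ZK_subset_K by (auto simp: pcong_def)
  hence "s x - of_int n = s (x - of_int n)" by (simp add: K_closed)
  thus ?thesis using assms s_P[of "x - of_int n"] by (simp add: pcong_def)
qed

lemma pcong_j: "pcong j 2" and pcong_\<theta>: "pcong \<theta> 2"
  by (simp_all add: pcong_def j_cong_2 \<theta>_cong_2 j_mem \<theta>_mem ZK_closed)

text \<open>Replacing \<open>j\<close> and \<open>\<theta>\<close> by 2 turns an element of
  \<open>ZK\<close> into an integer, so the residue field is Z/7.\<close>

lemma pcong_int:
  assumes "x \<in> ZK"
  obtains n where "pcong x (of_int n)"
proof -
  have Zj: "\<exists>n. pcong a (of_int n)" if a: "a \<in> Zj" for a
  proof -
    obtain p' q' where "p' \<in> \<int>" "q' \<in> \<int>" "a = p' + q' * j" using a by (rule quad_extE)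
    then obtain p q where a_eq: "a = of_int p + of_int q * j" by (auto elim!: Ints_cases)
    have "pcong a (of_int p + of_int q * 2)"
      unfolding a_eq by (intro pcong_add pcong_mult pcong_refl pcong_j ZK_closed)
    also have "of_int p + of_int q * 2 = (of_int (p + q * 2) :: complex)" by simp
    finally show ?thesis by blast
  qed
  obtain a b c where abc: "a \<in> Zj" "b \<in> Zj" "c \<in> Zj" "x = a + b * \<theta> + c * \<theta>^2"
    using assms by (rule cubic_extE)
  obtain l m n where lmn: "pcong a (of_int l)" "pcong b (of_int m)" "pcong c (of_int n)"
    using Zj abc by metis
  have "pcong x (of_int l + of_int m * 2 + of_int n * (2 * 2))"
    unfolding abc(4) power2_eq_square by (intro pcong_add pcong_mult lmn pcong_\<theta>)
  also have "of_int l + of_int m * 2 + of_int n * (2 * 2) = (of_int (l + m * 2 + n * 4) :: complex)" by simp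
  finally show ?thesis by (rule that)
qed

lemma pcong_N: "pcong x (of_int n) \<Longrightarrow> pcong (N x) (of_int (n * n * n))"
  unfolding N_def of_int_mult by (intro pcong_mult pcong_s)

lemma pcong_Tr: "pcong x (of_int n) \<Longrightarrow> pcong (Tr x) (of_int (n + n + n))"
  unfolding Tr_def of_int_add by (intro pcong_add pcong_s)

text \<open>\<open>2\<close> is not a cube modulo \<open>7\<close>; this is the norm form of the cubic extension of \<open>\<int>/7\<close>
  generated by a cube root of \<open>2\<close>.\<close>

lemma residue_form_anisotropic:
  fixes l m n :: int
  assumes "7 dvd l * l * l + 2 * (m * m * m) + 4 * (n * n * n) - 6 * (l * m * n)"
  shows "7 dvd l \<and> 7 dvd m \<and> 7 dvd n"
proof -
  \<comment> \<open>Only residues matter, which leaves 343 cases to check.\<close>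
  define L M N where "L = l mod 7" and "M = m mod 7" and "N = n mod 7"
  have LMN: "[L = l] (mod 7)" "[M = m] (mod 7)" "[N = n] (mod 7)"
    by (simp_all add: cong_def L_def M_def N_def)
  have "[L * L * L + 2 * (M * M * M) + 4 * (N * N * N) - 6 * (L * M * N) =
      l * l * l + 2 * (m * m * m) + 4 * (n * n * n) - 6 * (l * m * n)] (mod 7)"
    by (intro cong_add cong_diff cong_mult cong_refl LMN)
  hence "(L * L * L + 2 * (M * M * M) + 4 * (N * N * N) - 6 * (L * M * N)) mod 7 = 0"
    using assms by (simp add: cong_def)
  moreover have "L \<in> {0, 1, 2, 3, 4, 5, 6}" "M \<in> {0, 1, 2, 3, 4, 5, 6}" "N \<in> {0, 1, 2, 3, 4, 5, 6}"
    unfolding L_def M_def N_def by (simp, presburger)+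
  ultimately have "L = 0 \<and> M = 0 \<and> N = 0"
    unfolding insert_iff empty_iff by (elim disjE) simp_all
  thus ?thesis by (simp add: L_def M_def N_def mod_eq_0_iff_dvd)
qed

text \<open>Modulo \<open>P\<close> norms become cubes, the trace becomes multiplication by 3 and
  \<open>j\<close> becomes 2, so \<open>red_norm\<close> reduces to the form of
  \<open>residue_form_anisotropic\<close>.\<close>

lemma red_norm_eq_0_imp_P:
  assumes "x \<in> ZK" "y \<in> ZK" "z \<in> ZK" "red_norm x y z = 0"
  shows "x \<in> P" "y \<in> P" "z \<in> P"
proof -
  obtain l where l: "pcong x (of_int l)" using pcong_int[OF assms(1)] .
  obtain m where m: "pcong y (of_int m)" using pcong_int[OF assms(2)] .
  obtain n where n: "pcong z (of_int n)" using pcong_int[OF assms(3)] .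
  let ?f = "l * l * l + 2 * (m * m * m) + 4 * (n * n * n) - 6 * (l * m * n)"
  have "pcong (x * s y * s (s z)) (of_int (l * m * n))"
    unfolding of_int_mult by (intro pcong_mult pcong_s l m n)
  hence "pcong (red_norm x y z) (of_int (l * l * l) + 2 * of_int (m * m * m) + 2 * 2 * of_int (n * n * n)
      - 2 * of_int (l * m * n + l * m * n + l * m * n))"
    unfolding red_norm_def power2_eq_square
    by (intro pcong_add pcong_diff pcong_mult pcong_N pcong_Tr pcong_j l m n)
  also have "\<dots> = of_int ?f" by simp
  finally have "- of_int ?f \<in> P" by (simp add: pcong_def assms(4))
  hence "of_int ?f \<in> P" using P_minus by fastforce
  hence "7 dvd ?f" by (simp only: of_int_P_iff)
  hence "of_int l \<in> P" "of_int m \<in> P" "of_int n \<in> P"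
    using residue_form_anisotropic[of l m n] by (simp_all only: of_int_P_iff)
  moreover have "w \<in> P" if "pcong w (of_int k)" "of_int k \<in> P" for w k
    using P_add[of "w - of_int k" "of_int k"] that by (simp add: pcong_def)
  ultimately show "x \<in> P" "y \<in> P" "z \<in> P" using l m n by blast+
qed

text \<open>Every term contains one factor from each conjugate and so picks up
  \<open>N \<beta>\<close>, which is fixed by \<open>s\<close> and can be pulled out of the
  trace.\<close>

lemma red_norm_\<beta>:
  assumes "x \<in> K" "y \<in> K" "z \<in> K"
  shows "red_norm (\<beta> * x) (\<beta> * y) (\<beta> * z) = N \<beta> * red_norm x y z"
proof -
  have "\<beta> * x * s (\<beta> * y) * s (s (\<beta> * z)) = N \<beta> * (x * s y * s (s z))"
    using assms \<beta>_mem by (simp add: N_def)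
  moreover have "Tr (N \<beta> * w) = N \<beta> * Tr w" if "w \<in> K" for w
    using that N_K[OF \<beta>_mem(2)] s_N[OF \<beta>_mem(2)] by (simp add: Tr_def distrib_left)
  moreover have "x * s y * s (s z) \<in> K" by (intro K_closed s_K assms)
  ultimately show ?thesis
    unfolding red_norm_def by (simp only: N_mult[OF \<beta>_mem(2)] assms) (simp only: algebra_simps)
qed

text \<open>The squared modulus is the positive integer \<open>p^2 - p * q + q^2\<close>. This
  discreteness both ends the descent and bounds the determinants.\<close>

lemma cmod_Zj_ge_1:
  assumes "x \<in> Zj" "x \<noteq> 0"
  shows "cmod x \<ge> 1"
proof -
  obtain p' q' where "p' \<in> \<int>" "q' \<in> \<int>" "x = p' + q' * j" using assms(1) by (rule quad_extE)
  then obtain p q where x: "x = of_int p + of_int q * j" by (auto elim!: Ints_cases)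
  have "of_real ((cmod x)^2) = x * cnj x" by (rule complex_norm_square)
  also have "\<dots> = of_int (p^2 - p * q + q^2)"
    using j_square by (simp add: x cnj_j) Groebner_Basis.algebra
  also have "\<dots> = of_real (of_int (p^2 - p * q + q^2))" by simp
  finally have eq: "(cmod x)^2 = of_int (p^2 - p * q + q^2)" by (simp only: of_real_eq_iff)
  moreover have "(cmod x)^2 > 0" using assms(2) by simp
  ultimately have "p^2 - p * q + q^2 > 0" by (simp only: of_int_0_less_iff)
  hence "1 \<le> p^2 - p * q + q^2" by simp
  hence "of_int 1 \<le> (of_int (p^2 - p * q + q^2) :: real)" by (simp only: of_int_le_iff)
  hence "(cmod x)^2 \<ge> 1" unfolding eq by simp
  thus ?thesis by (simp add: power2_nonneg_ge_1_iff)
qed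

text \<open>Descent: a zero is divisible by \<open>\<beta>\<close>, and by
  \<open>red_norm_\<beta>\<close> the quotient is again a zero. As \<open>N \<beta>\<close> has
  squared modulus 7, each division lowers the sum by the factor 7; once it is below 1, the three
  norms in Z[j] vanish.\<close>

lemma red_norm_anisotropic_aux:
  assumes "x \<in> ZK" "y \<in> ZK" "z \<in> ZK" "red_norm x y z = 0"
    and "(cmod (N x))^2 + (cmod (N y))^2 + (cmod (N z))^2 < 7 ^ k"
  shows "x = 0 \<and> y = 0 \<and> z = 0"
  using assms
proof (induction k arbitrary: x y z)
  case 0
  have "w = 0" if "w \<in> ZK" "(cmod (N w))^2 < 1" for w
  proof (rule ccontr)
    have K: "w \<in> K" using that(1) ZK_subset_K by blast
    assume "w \<noteq> 0"
    hence "N w \<noteq> 0" using N_eq_0_iff[OF K] by simp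
    hence "cmod (N w) \<ge> 1" by (rule cmod_Zj_ge_1[OF N_Zj[OF that(1)]])
    hence "(cmod (N w))^2 \<ge> 1" by simp
    thus False using that(2) by simp
  qed
  moreover have "(cmod (N x))^2 \<ge> 0" "(cmod (N y))^2 \<ge> 0" "(cmod (N z))^2 \<ge> 0" by simp_all
  hence "(cmod (N x))^2 < 1" "(cmod (N y))^2 < 1" "(cmod (N z))^2 < 1"
    using "0.prems"(5) unfolding power_0 by linarith+
  ultimately show ?case using "0.prems"(1-3) by blast
next
  case (Suc k)
  note P = red_norm_eq_0_imp_P[OF Suc.prems(1-4)]
  obtain x' where x: "x' \<in> ZK" "x = \<beta> * x'" using P(1) by (auto simp: P_def)
  obtain y' where y: "y' \<in> ZK" "y = \<beta> * y'" using P(2) by (auto simp: P_def)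
  obtain z' where z: "z' \<in> ZK" "z = \<beta> * z'" using P(3) by (auto simp: P_def)
  have K: "x' \<in> K" "y' \<in> K" "z' \<in> K" using x y z ZK_subset_K by auto
  have \<beta>: "(cmod (N \<beta>))^2 = 7"
  proof -
    have "of_real ((cmod (N \<beta>))^2) = N \<beta> * cnj (N \<beta>)" by (rule complex_norm_square)
    also have "\<dots> = 7" using j_square by (simp add: N_\<beta> cnj_j) Groebner_Basis.algebra
    also have "\<dots> = of_real 7" by simp
    finally show ?thesis by (simp only: of_real_eq_iff)
  qed
  have "N \<beta> * red_norm x' y' z' = 0" using Suc.prems(4) red_norm_\<beta>[OF K] by (simp add: x y z)
  moreover have "N \<beta> \<noteq> 0" using \<beta> by auto
  ultimately have zero: "red_norm x' y' z' = 0" by simp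
  have "7 * ((cmod (N x'))^2 + (cmod (N y'))^2 + (cmod (N z'))^2) < 7 ^ Suc k"
    using Suc.prems(5) \<beta>
    by (simp only: x y z N_mult[OF \<beta>_mem(2)] K norm_mult power_mult_distrib distrib_left)
  hence "(cmod (N x'))^2 + (cmod (N y'))^2 + (cmod (N z'))^2 < 7 ^ k" by simp
  from Suc.IH[OF x(1) y(1) z(1) zero this] show ?case by (simp add: x y z)
qed

lemma red_norm_anisotropic:
  assumes "x \<in> ZK" "y \<in> ZK" "z \<in> ZK" "red_norm x y z = 0"
  shows "x = 0" "y = 0" "z = 0"
proof -
  obtain k where "(cmod (N x))^2 + (cmod (N y))^2 + (cmod (N z))^2 < 7 ^ k"
    using real_arch_pow[of 7] by auto
  from red_norm_anisotropic_aux[OF assms this] show "x = 0" "y = 0" "z = 0" by simp_all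
qed

end

section \<open>The Galois group\<close>

context eisenstein_cubic
begin

lemma galois_aut:
  assumes f: "f \<in> carrier (galois_group K Qj)" and "f \<theta> = \<theta>^2 - 2"
  shows "eisenstein_cubic_aut j \<theta> f"
proof unfold_locales
  fix a b c assume abc: "a \<in> Qj" "b \<in> Qj" "c \<in> Qj"
  hence K: "a \<in> K" "b \<in> K" "c \<in> K" using Qj_subset_K by auto
  have hom: "f (x * y) = f x * f y" "f (x + y) = f x + f y" if "x \<in> K" "y \<in> K" for x y
    using f that by (auto simp: galois_group_carrier_iff)
  have fix_F: "f x = x" if "x \<in> Qj" for x using f that by (auto simp: galois_group_carrier_iff)
  show "f (a + b * \<theta> + c * \<theta>^2) = a + b * (\<theta>^2 - 2) + c * (\<theta>^2 - 2)^2"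
    unfolding power2_eq_square[of \<theta>]
    by (simp only: hom fix_F abc K K_closed \<theta>_mem assms(2)) (simp only: power2_eq_square)
qed

lemma galois_eqI:
  assumes f: "f \<in> carrier (galois_group K Qj)" and g: "g \<in> carrier (galois_group K Qj)"
    and "f \<theta> = g \<theta>"
  shows "f = g"
proof (rule extensionalityI)
  show "f \<in> extensional K" "g \<in> extensional K"
    using f g by (auto simp: galois_group_carrier_iff)
  fix x assume "x \<in> K"
  then obtain a b c where x: "a \<in> Qj" "b \<in> Qj" "c \<in> Qj" "x = a + b * \<theta> + c * \<theta> * \<theta>"
    by (auto elim!: cubic_extE simp: power2_eq_square mult.assoc)
  hence K: "a \<in> K" "b \<in> K" "c \<in> K" using Qj_subset_K by auto
  have expand: "h x = a + b * h \<theta> + c * h \<theta> * h \<theta>" if h: "h \<in> carrier (galois_group K Qj)" for h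
  proof -
    have hom: "h (x * y) = h x * h y" "h (x + y) = h x + h y" if "x \<in> K" "y \<in> K" for x y
      using h that by (auto simp: galois_group_carrier_iff)
    have fix_F: "h x = x" if "x \<in> Qj" for x using h that by (auto simp: galois_group_carrier_iff)
    show ?thesis by (simp only: x hom fix_F K K_closed \<theta>_mem)
  qed
  show "f x = g x" unfolding expand[OF f] expand[OF g] assms(3) ..
qed

text \<open>The image of \<open>\<theta>\<close> is again a root of the cubic, which splits into the
  three listed linear factors.\<close>

lemma galois_image_\<theta>:
  assumes f: "f \<in> carrier (galois_group K Qj)"
  shows "f \<theta> = \<theta> \<or> f \<theta> = \<theta>^2 - 2 \<or> f \<theta> = 1 - \<theta> - \<theta>^2"
proof -
  have hom: "f (x * y) = f x * f y" "f (x + y) = f x + f y" if "x \<in> K" "y \<in> K" for x y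
    using f that by (auto simp: galois_group_carrier_iff)
  have fix_F: "f 1 = 1" "f 2 = 2" using f Qj_closed by (auto simp: galois_group_carrier_iff)
  have "\<theta> * \<theta> * \<theta> + \<theta> * \<theta> = 1 + 2 * \<theta>"
    using \<theta>_cube by Groebner_Basis.algebra
  hence "f (\<theta> * \<theta> * \<theta> + \<theta> * \<theta>) = f (1 + 2 * \<theta>)" by simp
  hence root: "f \<theta> * f \<theta> * f \<theta> + f \<theta> * f \<theta> = 1 + 2 * f \<theta>"
    by (simp only: hom fix_F K_closed \<theta>_mem)
  have "(y - \<theta>) * ((y - (\<theta>^2 - 2)) * (y - (1 - \<theta> - \<theta>^2))) = 0" if "y * y * y + y * y = 1 + 2 * y" for y
    using that \<theta>_cube by Groebner_Basis.algebra
  from this[OF root] show ?thesis by (simp only: mult_eq_0_iff right_minus_eq)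
qed

lemma ex_galois_aut: "\<exists>f \<in> carrier (galois_group K Qj). f \<theta> = \<theta>^2 - 2"
proof -
  \<comment> \<open>Well defined because coordinates are unique by \<open>Qj_coords_unique\<close>;
    the restriction to \<open>K\<close> makes the map extensional, as \<open>galois_group\<close>
    demands.\<close>
  define s where "s = (\<lambda>x\<in>K. THE y. \<exists>a\<in>Qj. \<exists>b\<in>Qj. \<exists>c\<in>Qj. x = a + b * \<theta> + c * \<theta>^2 \<and>
    y = a + b * (\<theta>^2 - 2) + c * (\<theta>^2 - 2)^2)"
  interpret s: eisenstein_cubic_aut j \<theta> s
  proof unfold_locales
    fix a b c assume abc: "a \<in> Qj" "b \<in> Qj" "c \<in> Qj"
    have "(THE y. \<exists>a'\<in>Qj. \<exists>b'\<in>Qj. \<exists>c'\<in>Qj. a + b * \<theta> + c * \<theta>^2 = a' + b' * \<theta> + c' * \<theta>^2 \<and>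
        y = a' + b' * (\<theta>^2 - 2) + c' * (\<theta>^2 - 2)^2) = a + b * (\<theta>^2 - 2) + c * (\<theta>^2 - 2)^2"
    proof (rule the_equality)
      fix y assume "\<exists>a'\<in>Qj. \<exists>b'\<in>Qj. \<exists>c'\<in>Qj. a + b * \<theta> + c * \<theta>^2 = a' + b' * \<theta> + c' * \<theta>^2 \<and>
        y = a' + b' * (\<theta>^2 - 2) + c' * (\<theta>^2 - 2)^2"
      then obtain a' b' c' where *: "a' \<in> Qj" "b' \<in> Qj" "c' \<in> Qj"
        and eq: "a + b * \<theta> + c * \<theta>^2 = a' + b' * \<theta> + c' * \<theta>^2"
        and y: "y = a' + b' * (\<theta>^2 - 2) + c' * (\<theta>^2 - 2)^2" by blast
      note unique = Qj_coords_unique[OF abc * eq]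
      show "y = a + b * (\<theta>^2 - 2) + c * (\<theta>^2 - 2)^2" unfolding y unique ..
    qed (use abc in blast)
    thus "s (a + b * \<theta> + c * \<theta>^2) = a + b * (\<theta>^2 - 2) + c * (\<theta>^2 - 2)^2"
      using cubic_extI[OF abc] by (simp add: s_def)
  qed
  have "s \<in> extensional K" by (simp add: s_def)
  hence "s \<in> carrier (galois_group K Qj)"
    by (simp add: galois_group_carrier_iff s.bij_s)
  thus ?thesis using s.s_\<theta> by blast
qed

text \<open>By \<open>galois_eqI\<close> an automorphism is determined by its value at
  \<open>\<theta>\<close>, and the three possible values are attained by the identity,
  \<open>s\<close> and its square.\<close>

lemma generates_galois_group:
  assumes s: "s \<in> carrier (galois_group K Qj)" "s \<theta> = \<theta>^2 - 2"
  shows "generates_galois_group K Qj s"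
  unfolding generates_galois_group_def
proof (intro conjI s)
  let ?G = "galois_group K Qj"
  interpret G: group ?G by (rule group_galois_group[OF subring_K Qj_subset_K])
  interpret s: eisenstein_cubic_aut j \<theta> s by (rule galois_aut[OF s])
  have Bij: "f \<in> Bij K" if "f \<in> carrier ?G" for f using that by (simp add: galois_group_def)
  have one: "\<one>\<^bsub>?G\<^esub> \<theta> = \<theta>" by (simp add: galois_group_def BijGroup_def \<theta>_mem)
  have ss: "(s \<otimes>\<^bsub>?G\<^esub> s) \<theta> = 1 - \<theta> - \<theta>^2"
    using Bij[OF s(1)] s.s_s_\<theta> by (simp add: galois_group_def BijGroup_def compose_eq \<theta>_mem)
  have mem: "\<one>\<^bsub>?G\<^esub> \<in> generate ?G {s}" "s \<in> generate ?G {s}" "s \<otimes>\<^bsub>?G\<^esub> s \<in> generate ?G {s}"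
    by (auto intro: generate.intros)
  show "generate ?G {s} = carrier ?G"
  proof
    show "generate ?G {s} \<subseteq> carrier ?G" using s by (intro G.generate_incl) simp
    show "carrier ?G \<subseteq> generate ?G {s}"
    proof
      fix f assume f: "f \<in> carrier ?G"
      have "f = \<one>\<^bsub>?G\<^esub> \<or> f = s \<or> f = s \<otimes>\<^bsub>?G\<^esub> s"
        using galois_image_\<theta>[OF f] galois_eqI[OF f G.one_closed] galois_eqI[OF f s(1)]
          galois_eqI[OF f G.m_closed[OF s(1) s(1)]] one ss s(2) by metis
      thus "f \<in> generate ?G {s}" using mem by blast
    qed
  qed
qed

lemma cyclic_extension_K: "cyclic_extension K Qj 3"
proof -
  obtain s where s: "s \<in> carrier (galois_group K Qj)" "s \<theta> = \<theta>^2 - 2" using ex_galois_aut by blast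
  interpret s: eisenstein_cubic_aut j \<theta> s by (rule galois_aut[OF s])
  \<comment> \<open>The single automorphism \<open>s\<close> already cuts the fixed elements down to
    Q(j).\<close>
  have "{x \<in> K. \<forall>\<tau>\<in>carrier (galois_group K Qj). \<tau> x = x} = Qj"
  proof
    show "{x \<in> K. \<forall>\<tau>\<in>carrier (galois_group K Qj). \<tau> x = x} \<subseteq> Qj"
      using s.fixed_imp_mem[OF order_refl] s(1) by blast
    show "Qj \<subseteq> {x \<in> K. \<forall>\<tau>\<in>carrier (galois_group K Qj). \<tau> x = x}"
      using Qj_subset_K by (auto simp: galois_group_carrier_iff)
  qed
  thus ?thesis
    using subfield_K subfield_Qj Qj_subset_K dimension_K generates_galois_group[OF s]
    by (auto simp: cyclic_extension_def galois_extension_def)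
qed

end

section \<open>Perfectness\<close>

lemma det_mat_1: "det (mat (Suc 0) (Suc 0) f) = f (0, 0)"
  by (subst det_single) auto

lemma det_mat_2: "det (mat 2 2 f) = f (0, 0) * f (1, 1) - f (1, 0) * (f (0, 1) :: 'a :: comm_ring_1)"
  by (subst laplace_expansion_column[of _ 2 0])
     (auto simp: cofactor_def mat_delete_def det_mat_1 numeral_2_eq_2)

lemma det_mat_3:
  "det (mat 3 3 f) = f (0, 0) * (f (1, 1) * f (2, 2) - f (2, 1) * f (1, 2))
    - f (1, 0) * (f (0, 1) * f (2, 2) - f (2, 1) * f (0, 2))
    + f (2, 0) * (f (0, 1) * f (1, 2) - f (1, 1) * (f (0, 2) :: 'a :: comm_ring_1))"
proof -
  have "det (mat 3 3 f) = (\<Sum>i<3. mat 3 3 f $$ (i, 0) * cofactor (mat 3 3 f) i 0)"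
    by (rule laplace_expansion_column) auto
  also have "\<dots> = (\<Sum>i<3. f (i, 0) * ((- 1) ^ i *
      det (mat 2 2 (\<lambda>(i', j'). f (if i' < i then i' else Suc i', Suc j')))))"
  proof (intro sum.cong refl)
    fix i :: nat assume "i \<in> {..<3}"
    hence i: "i < 3" by simp
    have "mat_delete (mat 3 3 f) i 0 = mat 2 2 (\<lambda>(i', j'). f (if i' < i then i' else Suc i', Suc j'))"
      by (rule eq_matI) (auto simp: mat_delete_def)
    thus "mat 3 3 f $$ (i, 0) * cofactor (mat 3 3 f) i 0 = f (i, 0) * ((- 1) ^ i *
      det (mat 2 2 (\<lambda>(i', j'). f (if i' < i then i' else Suc i', Suc j'))))"
      using i by (simp add: cofactor_def)
  qed
  also have "\<dots> = f (0, 0) * (f (1, 1) * f (2, 2) - f (2, 1) * f (1, 2))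
    - f (1, 0) * (f (0, 1) * f (2, 2) - f (2, 1) * f (0, 2))
    + f (2, 0) * (f (0, 1) * f (1, 2) - f (1, 1) * f (0, 2))"
    unfolding det_mat_2 by (simp add: numeral_3_eq_3 numeral_2_eq_2 algebra_simps)
  finally show ?thesis .
qed

context septic_code
begin

lemma layer_ZK:
  assumes "u \<in> information_symbols Qj 3" "l < 3"
  shows "layer 3 \<nu> u l \<in> ZK"
  unfolding layer_def
proof (rule subring_complexD(11)[OF subring_ZK])
  fix k :: nat assume k: "k \<in> {1..3}"
  hence "u l k \<in> ZK"
    using assms Zj_subset_ZK by (auto simp: information_symbols_def ring_of_integers_Qj)
  thus "u l k * \<nu> k \<in> ZK" by (intro ZK_closed \<nu>_ZK k)
qed

text \<open>The unscaled matrix represents an element of the cyclic algebra of \<open>K\<close> over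
  Q(j) with \<open>\<gamma> = j\<close>, and its determinant is the reduced norm: the three mixed
  terms of the expansion are the conjugates collected in \<open>Tr\<close>.\<close>

lemma det_codeword:
  assumes "u \<in> information_symbols Qj 3"
  shows "det (codeword 3 s j \<nu> 7 u) =
    complex_of_real (1 / sqrt 7) ^ 3 * red_norm (layer 3 \<nu> u 0) (layer 3 \<nu> u 1) (layer 3 \<nu> u 2)"
proof -
  define x y z where "x = layer 3 \<nu> u 0" and "y = layer 3 \<nu> u 1" and "z = layer 3 \<nu> u 2"
  have K: "x \<in> K" "y \<in> K" "z \<in> K"
    using layer_ZK[OF assms] ZK_subset_K by (auto simp: x_def y_def z_def)
  define M :: "complex mat" where
    "M = mat 3 3 (\<lambda>(r, q). if q \<ge> r then (s ^^ r) (layer 3 \<nu> u (q - r))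
                       else j * (s ^^ r) (layer 3 \<nu> u (q + 3 - r)))"
  have "det M = x * (s x * s (s x) - j * s (s z) * s y)
     - j * s z * (y * s (s x) - j * s (s z) * z)
     + j * s (s y) * (y * s y - s x * z)"
    unfolding M_def det_mat_3 by (simp add: numeral_2_eq_2 x_def y_def z_def)
  also have "\<dots> = red_norm x y z"
    using K by (simp add: red_norm_def N_def Tr_def K_closed) Groebner_Basis.algebra
  finally have "det M = red_norm x y z" .
  moreover have "det (codeword 3 s j \<nu> 7 u) = complex_of_real (1 / sqrt 7) ^ 3 * det M"
    unfolding codeword_def M_def[symmetric] by (simp add: det_smult M_def)
  ultimately show ?thesis by (simp only: x_def y_def z_def)
qed

lemma codeword_first_row:
  assumes "l < 3"
  shows "codeword 3 s j \<nu> 7 u $$ (0, l) = complex_of_real (1 / sqrt 7) * layer 3 \<nu> u l"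
  using assms by (simp add: codeword_def)

text \<open>The first row of a codeword shows the three layers up to scaling, and independence of
  \<open>\<nu>\<close> over Z[j] recovers the symbols from each layer.\<close>

lemma full_rate: "full_rate Qj 3 s j \<nu> 7"
  unfolding full_rate_def
proof (intro ballI impI allI)
  fix u v and l k :: nat
  assume u: "u \<in> information_symbols Qj 3" and v: "v \<in> information_symbols Qj 3"
    and eq: "codeword 3 s j \<nu> 7 u = codeword 3 s j \<nu> 7 v" and l: "l < 3" and k: "k \<in> {1..3}"
  have "layer 3 \<nu> u l = layer 3 \<nu> v l"
    using codeword_first_row[OF l, of u] codeword_first_row[OF l, of v] eq by simp
  hence "(\<Sum>k=1..3. (u l k - v l k) * \<nu> k) = 0"
    by (simp only: layer_def left_diff_distrib sum_subtractf) simp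
  moreover have "\<forall>k\<in>{1..3}. u l k - v l k \<in> Zj"
    using u v l by (auto simp: information_symbols_def ring_of_integers_Qj intro!: Zj_closed(6))
  moreover note is_basis_\<nu>[unfolded is_basis_def, THEN conjunct2, rule_format, of "\<lambda>k. u l k - v l k"]
  ultimately have "u l k - v l k = 0" using k by blast
  thus "u l k = v l k" by simp
qed

lemma nonvanishing_determinant: "nonvanishing_determinant Qj 3 s j \<nu> 7"
  unfolding nonvanishing_determinant_def
\<comment> \<open>The scaling \<open>1 / sqrt 7\<close> enters the determinant to the third power,
  hence its squared modulus as \<open>1 / 7^3\<close>.\<close>
proof (intro exI[of _ "1 / 343"] conjI ballI impI)
  fix C assume "C \<in> infinite_code Qj 3 s j \<nu> 7" and "C \<noteq> 0\<^sub>m 3 3"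
  then obtain u where u: "u \<in> information_symbols Qj 3" and C: "C = codeword 3 s j \<nu> 7 u"
    by (auto simp: infinite_code_def)
  define x y z where "x = layer 3 \<nu> u 0" and "y = layer 3 \<nu> u 1" and "z = layer 3 \<nu> u 2"
  have ZK: "x \<in> ZK" "y \<in> ZK" "z \<in> ZK"
    using layer_ZK[OF u] by (auto simp: x_def y_def z_def)
  have "red_norm x y z \<noteq> 0"
  proof
    assume zero: "red_norm x y z = 0"
    have layer_0: "layer 3 \<nu> u l = 0" if "l < 3" for l
      using less_3_cases[OF that] red_norm_anisotropic[OF ZK zero]
      by (elim disjE) (simp_all only: x_def y_def z_def)
    have s_0: "(s ^^ r) 0 = 0" for r by (induction r) simp_all
    have "C = 0\<^sub>m 3 3"
      unfolding C codeword_def by (rule eq_matI) (simp_all add: layer_0 s_0)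
    thus False using \<open>C \<noteq> 0\<^sub>m 3 3\<close> by simp
  qed
  hence "cmod (red_norm x y z) \<ge> 1" by (rule cmod_Zj_ge_1[OF red_norm_Zj[OF ZK]])
  hence ge: "(cmod (red_norm x y z))^2 \<ge> 1" by simp
  have "(cmod (complex_of_real (1 / sqrt 7) ^ 3))^2 = ((1 / sqrt 7)^2)^3"
    by (simp add: norm_power norm_divide flip: power_mult)
  also have "\<dots> = 1 / 343" by (simp add: power_divide)
  finally have "(cmod (det C))^2 = 1 / 343 * (cmod (red_norm x y z))^2"
    unfolding C det_codeword[OF u] x_def y_def z_def by (simp add: norm_mult power_mult_distrib)
  thus "1 / 343 \<le> (cmod (det C))^2" using ge by simp
qed simp

lemma cmod_j: "cmod j = 1"
proof -
  have "of_real ((cmod j)^2) = j * cnj j" by (rule complex_norm_square)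
  also have "\<dots> = 1" unfolding cnj_j using j_square by Groebner_Basis.algebra
  finally have "(cmod j)^2 = 1" by (simp only: of_real_eq_1_iff)
  thus ?thesis by (simp add: power2_eq_1_iff) (metis norm_ge_zero not_one_le_zero le_minus_one_simps(3))
qed

lemma perfect: "perfect_code Qj 3 s j \<nu> 7"
  unfolding perfect_code_def
  using full_rate nonvanishing_determinant unitary_layer_encoding_matrix cmod_j by blast

lemma ideal_\<alpha>: "ideal (PIdl\<^bsub>subring_of ZK\<^esub> (1 + j + \<theta>)) (subring_of ZK)"
proof -
  have "subcring ZK \<C>" by (rule cring.subcringI'[OF cring_complex subring_ZK])
  hence "cring (subring_of ZK)" using ring.subcring_iff[OF ring_complex] by simp
  moreover have "1 + j + \<theta> \<in> carrier (subring_of ZK)"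
    by (simp add: ZK_closed j_mem \<theta>_mem)
  ultimately show ?thesis by (rule cring.cgenideal_ideal)
qed

lemma code_parameters:
  assumes "s \<in> carrier (galois_group K Qj)" and "Qj = adjoin {exp (2 * of_real pi * \<i> / 3)}"
  shows "code_parameters K Qj 3 s j \<nu> 7"
proof -
  have "j \<noteq> 0" using cmod_j by auto
  moreover have "1 + j + \<theta> \<in> PIdl\<^bsub>subring_of ZK\<^esub> (1 + j + \<theta>)"
    by (auto simp: cgenideal_def intro!: exI[of _ 1] ZK_closed)
  hence "PIdl\<^bsub>subring_of ZK\<^esub> (1 + j + \<theta>) \<noteq> {0}" using \<alpha>_nonzero by blast
  ultimately show ?thesis
    using assms(2) cyclic_extension_K generates_galois_group[OF assms(1) s_\<theta>] j_mem(1) ideal_\<alpha> is_basis_\<nu>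
    unfolding code_parameters_def ring_of_integers_K ring_of_integers_Qj by auto
qed

end

section \<open>The concrete numbers \<open>j\<close>, \<open>\<zeta>\<close> and
  \<open>\<theta>\<close>\<close>

lemma eisenstein_cubic_septic:
  assumes "j = exp (2 * of_real pi * \<i> / 3)" "\<zeta> = exp (2 * of_real pi * \<i> / 7)"
    "\<theta> = of_real (2 * cos (2 * pi / 7))"
  shows "\<theta> = \<zeta> + inverse \<zeta>" "\<theta>^2 - 2 = \<zeta>^2 + inverse (\<zeta>^2)" "eisenstein_cubic j \<theta>"
proof -
  have \<zeta>: "\<zeta> = cis (2 * pi / 7)" by (simp add: assms(2) cis_conv_exp mult_ac)
  hence ne: "\<zeta> \<noteq> 0" by simp
  \<comment> \<open>Replaces the inverse by a variable with \<open>\<zeta> * w = 1\<close>, so that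
    the identities below become polynomial.\<close>
  define w where "w = inverse \<zeta>"
  have w: "\<zeta> * w = 1" using ne by (simp add: w_def)
  show \<theta>: "\<theta> = \<zeta> + inverse \<zeta>"
    by (simp add: assms(3) \<zeta> complex_eq_iff)
  hence \<theta>w: "\<theta> = \<zeta> + w" by (simp add: w_def)
  have "inverse (\<zeta>^2) = w^2" by (simp add: w_def power_inverse)
  moreover have "\<theta>^2 - 2 = \<zeta>^2 + w^2" unfolding \<theta>w using w by Groebner_Basis.algebra
  ultimately show "\<theta>^2 - 2 = \<zeta>^2 + inverse (\<zeta>^2)" by simp
  have "\<zeta> \<noteq> 1"
  proof
    assume "\<zeta> = 1"
    hence "sin (2 * pi / 7) = 0" using \<zeta> by (simp add: complex_eq_iff)
    moreover have "sin (2 * pi / 7) > 0" by (rule sin_gt_zero) auto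
    ultimately show False by simp
  qed
  moreover have "\<zeta>^7 = 1" unfolding \<zeta> by (simp add: DeMoivre)
  hence "(\<zeta> - 1) * (\<zeta>^6 + \<zeta>^5 + \<zeta>^4 + \<zeta>^3 + \<zeta>^2 + \<zeta> + 1) = 0" by Groebner_Basis.algebra
  ultimately have sum: "\<zeta>^6 + \<zeta>^5 + \<zeta>^4 + \<zeta>^3 + \<zeta>^2 + \<zeta> + 1 = 0"
    by (simp only: mult_eq_0_iff right_minus_eq) simp
  \<comment> \<open>Multiplying the seventh cyclotomic polynomial by \<open>w^3\<close> makes it
    symmetric in \<open>\<zeta>\<close> and \<open>w\<close>, hence a polynomial in their sum
    \<open>\<theta>\<close>.\<close>
  have "(\<zeta> + w)^3 + (\<zeta> + w)^2 - 2 * (\<zeta> + w) - 1 =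
      w^3 * (\<zeta>^6 + \<zeta>^5 + \<zeta>^4 + \<zeta>^3 + \<zeta>^2 + \<zeta> + 1)"
    using w by Groebner_Basis.algebra
  hence cubic: "\<theta>^3 + \<theta>^2 - 2 * \<theta> - 1 = 0" unfolding \<theta>w sum by simp
  have j: "j = cis (2 * pi / 3)" by (simp add: assms(1) cis_conv_exp mult_ac)
  show "eisenstein_cubic j \<theta>"
  proof unfold_locales
    show "j^2 = - 1 - j"
      by (simp add: j complex_eq_iff cos_120 sin_120 power2_eq_square)
    show "\<theta>^3 = 1 + 2 * \<theta> - \<theta>^2" using cubic by Groebner_Basis.algebra
    show "\<theta> \<in> \<real>" by (simp add: assms(3))
  qed
qed

theorem mainTheorem2:
  fixes j \<zeta> \<theta> \<alpha> \<gamma> :: complex and F K I :: "complex set" and \<nu> :: "nat \<Rightarrow> complex"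
  assumes "j = exp (2 * of_real pi * \<i> / 3)"
    and "\<zeta> = exp (2 * of_real pi * \<i> / 7)"
    and "\<theta> = of_real (2 * cos (2 * pi / 7))"
    and "F = adjoin {j}"
    and "K = adjoin {j, \<theta>}"
    and "\<gamma> = j"
    and "\<alpha> = (1 + j) + \<theta>"
    and "I = PIdl\<^bsub>subring_of (ring_of_integers K)\<^esub> \<alpha>"
    and "\<nu> 1 = (1 + j) + \<theta>"
    and "\<nu> 2 = (- 1 - 2 * j) + j * \<theta> ^ 2"
    and "\<nu> 3 = (- 1 - 2 * j) + (1 + j) * \<theta> + (1 + j) * \<theta> ^ 2"
  shows "\<theta> = \<zeta> + inverse \<zeta> \<and>
    (\<exists>!\<sigma>. \<sigma> \<in> carrier (galois_group K F) \<and>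
          \<sigma> (\<zeta> + inverse \<zeta>) = \<zeta> ^ 2 + inverse (\<zeta> ^ 2)) \<and>
    \<alpha> \<in> ring_of_integers K \<and>
    is_basis (generate_ring \<C> {j}) 3 \<nu> I \<and>
    (\<forall>\<sigma>. \<sigma> \<in> carrier (galois_group K F) \<and>
          \<sigma> (\<zeta> + inverse \<zeta>) = \<zeta> ^ 2 + inverse (\<zeta> ^ 2) \<longrightarrow>
          generates_galois_group K F \<sigma> \<and>
          code_parameters K F 3 \<sigma> \<gamma> \<nu> 7 \<and>
          perfect_code F 3 \<sigma> \<gamma> \<nu> 7)"
proof -
  interpret eisenstein_cubic j \<theta> by (rule eisenstein_cubic_septic(3)[OF assms(1-3)])
  note \<zeta> = eisenstein_cubic_septic(1,2)[OF assms(1-3), symmetric]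
  have F: "F = Qj" and K: "K = cubic_ext \<theta> Qj"
    unfolding assms(4,5) by (rule adjoin_j adjoin_j_\<theta>)+
  \<comment> \<open>Every admissible automorphism fits the locale, so perfectness can be concluded
    for an arbitrary one.\<close>
  have code: "septic_code j \<theta> \<sigma> \<nu>"
    if "\<sigma> \<in> carrier (galois_group K F)" "\<sigma> \<theta> = \<theta>^2 - 2" for \<sigma>
    using galois_aut that assms(9-11)
    by (auto simp: F K septic_code_def septic_code_axioms_def)
  \<comment> \<open>The ring of integers and the basis property are established in a locale
    containing an automorphism, so one is fixed even for the claims that do not mention it.\<close>
  obtain \<sigma> where \<sigma>: "\<sigma> \<in> carrier (galois_group K F)" "\<sigma> \<theta> = \<theta>^2 - 2"
    using ex_galois_aut unfolding F K by blast
  interpret septic_code j \<theta> \<sigma> \<nu> by (rule code[OF \<sigma>])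
  have ZK: "ring_of_integers K = ZK" unfolding K by (rule ring_of_integers_K)
  show ?thesis
  proof (intro conjI allI impI)
    show "\<theta> = \<zeta> + inverse \<zeta>" using \<zeta>(1) by (rule sym)
    show "\<exists>!\<sigma>. \<sigma> \<in> carrier (galois_group K F) \<and> \<sigma> (\<zeta> + inverse \<zeta>) = \<zeta> ^ 2 + inverse (\<zeta> ^ 2)"
      unfolding \<zeta>
    proof (rule ex1I)
      show "\<sigma> \<in> carrier (galois_group K F) \<and> \<sigma> \<theta> = \<theta>^2 - 2" using \<sigma> ..
      show "\<tau> = \<sigma>" if "\<tau> \<in> carrier (galois_group K F) \<and> \<tau> \<theta> = \<theta>^2 - 2" for \<tau>
        using that \<sigma> unfolding F K by (intro galois_eqI) simp_all
    qed
    show "\<alpha> \<in> ring_of_integers K"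
      unfolding ZK assms(7) by (intro ZK_closed j_mem \<theta>_mem)
    show "is_basis (generate_ring \<C> {j}) 3 \<nu> I"
      unfolding assms(7,8) ZK generate_ring_j by (rule is_basis_\<nu>)
  next
    fix \<tau> assume \<tau>: "\<tau> \<in> carrier (galois_group K F) \<and> \<tau> (\<zeta> + inverse \<zeta>) = \<zeta> ^ 2 + inverse (\<zeta> ^ 2)"
    hence \<tau>': "\<tau> \<in> carrier (galois_group K F)" "\<tau> \<theta> = \<theta>^2 - 2" unfolding \<zeta> by auto
    interpret \<tau>: septic_code j \<theta> \<tau> \<nu> by (rule code[OF \<tau>'])
    show "generates_galois_group K F \<tau>"
      using \<tau>' unfolding F K by (rule generates_galois_group)
    show "code_parameters K F 3 \<tau> \<gamma> \<nu> 7"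
      using \<tau>' adjoin_j unfolding F K assms(6) assms(1) by (intro \<tau>.code_parameters[unfolded assms(1)]) auto
    show "perfect_code F 3 \<tau> \<gamma> \<nu> 7"
      unfolding F assms(6) by (rule \<tau>.perfect)
  qed
qed

end
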